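(* Let $t\ge1$ be an integer, let $S_j=\{p_{1j},\ldots,p_{n_jj}\}$ ($j=1,\ldots,t$) be pairwise disjoint sets of prime numbers with $|S_j|=n_j>2$, let $N_j,N_j'$ be positive integers, and let $\Sigma_t=\bigsqcup_{j=1}^tS_j$. Let $T_1,T_2\subset\{1,\ldots,t\}$ be disjoint (possibly empty) subsets, and let $\Gamma_t,\Gamma_t'\subset\mathbb{Z}_{\Sigma_t}^\times\times\mathbb{Z}_{\Sigma_t}^\times$ be the subgroups defined in the context. Let $\mathcal{T}=\mathbb{G}_m\times_{\operatorname{spec}\mathbb{Z}_{\Sigma_t}}\mathbb{G}_m$. Consider the Deligne 1-motives $[\Gamma_t\to\mathcal{T}]$, $[\Gamma_t'\to\mathcal{T}]$, $[\Gamma_t\cap\Gamma_t'\to\mathcal{T}]$ and $[\Gamma_t\cdot\Gamma_t'\to\mathcal{T}]$ over $\operatorname{spec}\mathbb{Z}_{\Sigma_t}$. Then, for each prime $p\notin\Sigma_t$, after changing the base to $\operatorname{spec}\mathbb{F}_p$ and taking the images of the subgroups $\Gamma_t,\Gamma_t',\Gamma_t\cap\Gamma_t',\Gamma_t\cdot\Gamma_t'$ in $T_p(\mathbb{F}_p)=\mathbb{F}_p^\times\times\mathbb{F}_p^\times$ under the reduction map $r_p$, the torsion 1-motives $[r_p(\Gamma_t)\to T_p]$, $[r_p(\Gamma_t')\to T_p]$, $[r_p(\Gamma_t\cap\Gamma_t')\to T_p]$ and $[r_p(\Gamma_t\cdot\Gamma_t')\to T_p]$ are all equal.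
   Context: $\mathbb{Z}_{\Sigma_t}$ is the ring obtained from $\mathbb{Z}$ by inverting all primes in $\Sigma_t$. Elements of $\mathbb{Z}_{\Sigma_t}^\times\times\mathbb{Z}_{\Sigma_t}^\times$ are written as column vectors, with componentwise multiplication. For each $j$ put $$\lambda_j=\begin{bmatrix}1\\ p_{1j}^{N_j}\end{bmatrix},\quad \lambda_{1j}=\begin{bmatrix}p_{1j}\\ 1\end{bmatrix},\quad \lambda_{ij}=\begin{bmatrix}p_{ij}\\ p_{(i-1)j}\end{bmatrix}\ (2\le i\le n_j),\quad \lambda_{(n_j+1)j}=\begin{bmatrix}1\\ p_{n_jj}\end{bmatrix},\quad \lambda_j'=\begin{bmatrix}p_{n_jj}^{N_j'}\\ 1\end{bmatrix},$$ and let $M_j=\lambda_{1j}^{\mathbb{Z}}\cdot\lambda_{2j}^{\mathbb{Z}}\cdots\lambda_{(n_j+1)j}^{\mathbb{Z}}$. Define - $\Lambda_j=\lambda_j^{\mathbb{Z}}\cdot M_j$ and $\Lambda_j'=M_j\cdot\lambda_j'^{\mathbb{Z}}$ if $j\notin T_1\cup T_2$; - $\Lambda_j=\lambda_j^{\mathbb{Z}}\cdot M_j$ and $\Lambda_j'=M_j$ if $j\in T_1$; - $\Lambda_j=M_j$ and $\Lambda_j'=M_j\cdot\lambda_j'^{\mathbb{Z}}$ if $j\in T_2$. Put $\Gamma_t=\Lambda_1\cdots\Lambda_t$ and $\Gamma_t'=\Lambda_1'\cdots\Lambda_t'$. (The basic case is $T_1=T_2=\emptyset$.) For a prime $p\notin\Sigma_t$,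 $r_p:\mathbb{Z}_{\Sigma_t}^\times\times\mathbb{Z}_{\Sigma_t}^\times\to\mathbb{F}_p^\times\times\mathbb{F}_p^\times$ is componentwise reduction modulo $p$, and $T_p=\mathbb{G}_m^2$ over $\mathbb{F}_p$. A torsion 1-motive over a noetherian regular scheme $\mathcal{S}$, written $[\mathcal{Y}\to\mathcal{Z}]$, is a diagram in the category of sheaves of commutative groups on the fppf site over $\mathcal{S}$ consisting of an exact sequence $0\to\mathcal{X}\to\mathcal{Z}\to\mathcal{A}\to0$ and a morphism $u:\mathcal{Y}\to\mathcal{Z}$, where $\mathcal{Y}$ is an extension of a lattice by a finite flat group scheme, $\mathcal{X}$ is an extension of a finite flat group scheme by a torus, and $\mathcal{A}$ is an abelian scheme. A Deligne 1-motive is the case where $\mathcal{Y}$ is a lattice and $\mathcal{X}$ is a torus (so $\mathcal{Z}$ is a semiabelian scheme). Here $\mathcal{A}=0$. For a subgroup $\Gamma_0$ of $\mathbb{Z}_{\Sigma_t}^\times\times\mathbb{Z}_{\Sigma_t}^\times$ that is a lattice, $[\Gamma_0\to\mathcal{T}]$ is given by the inclusion $\Gamma_0\subset\mathcal{T}(\mathbb{Z}_{\Sigma_t})$, and $[r_p(\Gamma_0)\to T_p]$ is given by the inclusion of the finite group $r_p(\Gamma_0)\subset T_p(\mathbb{F}_p)$ (viewed as a constant group scheme). *)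

theory Defs
  imports
    "HOL-Algebra.Free_Abelian_Groups"
    "HOL-Number_Theory.Residues"
begin

section \<open>Functors of points over an affine base\<close>

text \<open>
  Sheaves of commutative groups on the fppf site over \<open>Spec B\<close> are determined by their
  sections on affine schemes, so they are represented here by their functors of points
  on commutative \<open>B\<close>-algebras.  An algebra is a ring together with its structure map.
  The type \<open>'r\<close> of ring elements plays the role of the universe bounding the site.
  Morphisms and equality of sheaves are morphisms and equality of the underlying functors.
\<close>

type_synonym ('b, 'r) algebra = "'r ring \<times> ('b \<Rightarrow> 'r)"

definition algebras :: "'b ring \<Rightarrow> ('b, 'r) algebra set" where
  "algebras B = {(R, \<phi>). cring R \<and> \<phi> \<in> ring_hom B R}"

definition algebra_hom ::
    "'b ring \<Rightarrow> ('b, 'r) algebra \<Rightarrow> ('b, 'r) algebra \<Rightarrow> ('r \<Rightarrow> 'r) set" where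
  "algebra_hom B S S' =
     {h \<in> ring_hom (fst S) (fst S'). \<forall>b \<in> carrier B. h (snd S b) = snd S' b}"

record ('b, 'r, 's) group_functor =
  sections :: "('b, 'r) algebra \<Rightarrow> 's monoid"
  restriction :: "('b, 'r) algebra \<Rightarrow> ('b, 'r) algebra \<Rightarrow> ('r \<Rightarrow> 'r) \<Rightarrow> 's \<Rightarrow> 's"

text \<open>
  Algebra homomorphisms only matter on carriers; the last two clauses are the identity and
  composition laws up to agreement on carriers.
\<close>

definition is_group_functor :: "'b ring \<Rightarrow> ('b, 'r, 's) group_functor \<Rightarrow> bool" where
  "is_group_functor B F \<longleftrightarrow>
     (\<forall>S \<in> algebras B. comm_group (sections F S)) \<and>
     (\<forall>S \<in> algebras B. \<forall>S' \<in> algebras B. \<forall>h \<in> algebra_hom B S S'.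
        restriction F S S' h \<in> hom (sections F S) (sections F S')) \<and>
     (\<forall>S \<in> algebras B. \<forall>h \<in> algebra_hom B S S.
        (\<forall>x \<in> carrier (fst S). h x = x) \<longrightarrow>
        (\<forall>s \<in> carrier (sections F S). restriction F S S h s = s)) \<and>
     (\<forall>S \<in> algebras B. \<forall>S' \<in> algebras B. \<forall>S'' \<in> algebras B.
        \<forall>h \<in> algebra_hom B S S'. \<forall>k \<in> algebra_hom B S' S''. \<forall>m \<in> algebra_hom B S S''.
        (\<forall>x \<in> carrier (fst S). m x = k (h x)) \<longrightarrow>
        (\<forall>s \<in> carrier (sections F S).
           restriction F S S'' m s = restriction F S' S'' k (restriction F S S' h s)))"

definition is_functor_hom ::
    "'b ring \<Rightarrow> ('b, 'r, 's) group_functor \<Rightarrow> ('b, 'r, 't) group_functor \<Rightarrow>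
     (('b, 'r) algebra \<Rightarrow> 's \<Rightarrow> 't) \<Rightarrow> bool" where
  "is_functor_hom B F G \<alpha> \<longleftrightarrow>
     (\<forall>S \<in> algebras B. \<alpha> S \<in> hom (sections F S) (sections G S)) \<and>
     (\<forall>S \<in> algebras B. \<forall>S' \<in> algebras B. \<forall>h \<in> algebra_hom B S S'.
        \<forall>s \<in> carrier (sections F S).
          \<alpha> S' (restriction F S S' h s) = restriction G S S' h (\<alpha> S s))"

definition zero_functor :: "('b, 'r, unit) group_functor" where
  "zero_functor = \<lparr>sections = (\<lambda>S. singleton_group ()), restriction = (\<lambda>S S' h s. s)\<rparr>"

text \<open>The split torus \<open>G\<^sub>m \<times> G\<^sub>m\<close>.\<close>

definition Gm2 :: "'r ring \<Rightarrow> ('r \<times> 'r) monoid" where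
  "Gm2 R = units_of R \<times>\<times> units_of R"

definition torus_functor :: "('b, 'r, 'r \<times> 'r) group_functor" where
  "torus_functor =
     \<lparr>sections = (\<lambda>S. Gm2 (fst S)), restriction = (\<lambda>S S' h s. (h (fst s), h (snd s)))\<rparr>"

text \<open>
  The constant group scheme on a discrete commutative group \<open>G\<close>: its \<open>R\<close>-points are the
  locally constant functions \<open>s : Spec R \<rightarrow> G\<close>.  As \<open>Spec R\<close> is quasi-compact, such a
  function is the same as a finitely supported family \<open>e\<close> of pairwise orthogonal
  idempotents of \<open>R\<close> with sum one, \<open>e g\<close> being the idempotent that cuts out the open and
  closed set \<open>s = g\<close> (idempotency follows from orthogonality and sum one).  The product of
  functions becomes the convolution of families.
\<close>

definition supp :: "'g monoid \<Rightarrow> 'r ring \<Rightarrow> ('g \<Rightarrow> 'r) \<Rightarrow> 'g set" where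
  "supp G R e = {g \<in> carrier G. e g \<noteq> \<zero>\<^bsub>R\<^esub>}"

definition const_sections :: "'g monoid \<Rightarrow> 'r ring \<Rightarrow> ('g \<Rightarrow> 'r) monoid" where
  "const_sections G R =
     \<lparr>carrier =
        {e \<in> carrier G \<rightarrow>\<^sub>E carrier R.
           finite (supp G R e) \<and>
           (\<forall>g \<in> carrier G. \<forall>h \<in> carrier G. g \<noteq> h \<longrightarrow> e g \<otimes>\<^bsub>R\<^esub> e h = \<zero>\<^bsub>R\<^esub>) \<and>
           finsum R e (supp G R e) = \<one>\<^bsub>R\<^esub>},
      monoid.mult = (\<lambda>e f. \<lambda>c \<in> carrier G.
        finsum R (\<lambda>a. e a \<otimes>\<^bsub>R\<^esub> f (inv\<^bsub>G\<^esub> a \<otimes>\<^bsub>G\<^esub> c)) (supp G R e)),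
      one = (\<lambda>g \<in> carrier G. if g = \<one>\<^bsub>G\<^esub> then \<one>\<^bsub>R\<^esub> else \<zero>\<^bsub>R\<^esub>)\<rparr>"

definition const_functor :: "'g monoid \<Rightarrow> ('b, 'r, 'g \<Rightarrow> 'r) group_functor" where
  "const_functor G =
     \<lparr>sections = (\<lambda>S. const_sections G (fst S)),
      restriction = (\<lambda>S S' h e. \<lambda>g \<in> carrier G. h (e g))\<rparr>"


section \<open>1-motives\<close>

text \<open>A diagram consisting of \<open>X \<rightarrow> Z \<rightarrow> A\<close> and \<open>u : Y \<rightarrow> Z\<close>.\<close>

record ('b, 'r, 'y, 'x, 'z, 'a) motive =
  mot_Y :: "('b, 'r, 'y) group_functor"
  mot_X :: "('b, 'r, 'x) group_functor"
  mot_Z :: "('b, 'r, 'z) group_functor"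
  mot_A :: "('b, 'r, 'a) group_functor"
  mot_i :: "('b, 'r) algebra \<Rightarrow> 'x \<Rightarrow> 'z"
  mot_q :: "('b, 'r) algebra \<Rightarrow> 'z \<Rightarrow> 'a"
  mot_u :: "('b, 'r) algebra \<Rightarrow> 'y \<Rightarrow> 'z"

text \<open>
  Exactness of \<open>0 \<rightarrow> X \<rightarrow> Z \<rightarrow> A \<rightarrow> 0\<close> is required on sections.  For sheaves the last map need
  only be locally surjective; below \<open>A = 0\<close>, where this makes no difference.
\<close>

definition motive_diagram :: "'b ring \<Rightarrow> ('b, 'r, 'y, 'x, 'z, 'a) motive \<Rightarrow> bool" where
  "motive_diagram B M \<longleftrightarrow>
     is_group_functor B (mot_Y M) \<and> is_group_functor B (mot_X M) \<and>
     is_group_functor B (mot_Z M) \<and> is_group_functor B (mot_A M) \<and>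
     is_functor_hom B (mot_X M) (mot_Z M) (mot_i M) \<and>
     is_functor_hom B (mot_Z M) (mot_A M) (mot_q M) \<and>
     is_functor_hom B (mot_Y M) (mot_Z M) (mot_u M) \<and>
     (\<forall>S \<in> algebras B.
        inj_on (mot_i M S) (carrier (sections (mot_X M) S)) \<and>
        mot_i M S ` carrier (sections (mot_X M) S) =
          kernel (sections (mot_Z M) S) (sections (mot_A M) S) (mot_q M S) \<and>
        mot_q M S ` carrier (sections (mot_Z M) S) = carrier (sections (mot_A M) S))"

definition is_lattice :: "'g monoid \<Rightarrow> bool" where
  "is_lattice G \<longleftrightarrow> comm_group G \<and> (\<exists>n::nat. G \<cong> free_Abelian_group {..<n})"

definition lattice_by_finite :: "'g monoid \<Rightarrow> bool" where
  "lattice_by_finite G \<longleftrightarrow>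
     comm_group G \<and> (\<exists>H. subgroup H G \<and> finite H \<and> is_lattice (G Mod H))"

type_synonym ('b, 'r, 'g) toric_motive =
  "('b, 'r, 'g \<Rightarrow> 'r, 'r \<times> 'r, 'r \<times> 'r, unit) motive"

text \<open>
  Deligne and torsion 1-motives with constant \<open>Y\<close>, with \<open>X\<close> the split torus of rank two and
  with \<open>A = 0\<close>.  A constant group scheme on a finite group is finite and flat, so a constant
  \<open>Y\<close> on an extension of a lattice by a finite group is an extension as required of a torsion
  1-motive; \<open>X\<close> is the extension of the trivial finite group scheme by the torus.
\<close>

definition split_deligne_1_motive :: "'b ring \<Rightarrow> ('b, 'r, 'g) toric_motive \<Rightarrow> bool" where
  "split_deligne_1_motive B M \<longleftrightarrow>
     motive_diagram B M \<and> (\<exists>G. is_lattice G \<and> mot_Y M = const_functor G) \<and>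
     mot_X M = torus_functor \<and> mot_A M = zero_functor"

definition split_torsion_1_motive :: "'b ring \<Rightarrow> ('b, 'r, 'g) toric_motive \<Rightarrow> bool" where
  "split_torsion_1_motive B M \<longleftrightarrow>
     motive_diagram B M \<and> (\<exists>G. lattice_by_finite G \<and> mot_Y M = const_functor G) \<and>
     mot_X M = torus_functor \<and> mot_A M = zero_functor"

text \<open>
  For a subgroup \<open>\<Gamma>\<close> of the \<open>B\<close>-points of the torus, the diagram \<open>[\<Gamma> \<rightarrow> T]\<close> over \<open>Spec B\<close>
  given by the inclusion.  On the part of \<open>Spec R\<close> where a locally constant function takes
  the value \<open>g\<close>, its image in \<open>T(R)\<close> is the image of \<open>g\<close> under the structure map; summing
  over the idempotents glues these.
\<close>

definition incl_map ::
    "('b \<times> 'b) monoid \<Rightarrow> ('b, 'r) algebra \<Rightarrow> ('b \<times> 'b \<Rightarrow> 'r) \<Rightarrow> 'r \<times> 'r" where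
  "incl_map G S e =
     (finsum (fst S) (\<lambda>g. e g \<otimes>\<^bsub>fst S\<^esub> snd S (fst g)) (supp G (fst S) e),
      finsum (fst S) (\<lambda>g. e g \<otimes>\<^bsub>fst S\<^esub> snd S (snd g)) (supp G (fst S) e))"

definition subgroup_motive ::
    "'b ring \<Rightarrow> ('b \<times> 'b) set \<Rightarrow> ('b, 'r, 'b \<times> 'b) toric_motive" where
  "subgroup_motive B \<Gamma> =
     \<lparr>mot_Y = const_functor ((Gm2 B)\<lparr>carrier := \<Gamma>\<rparr>),
      mot_X = torus_functor,
      mot_Z = torus_functor,
      mot_A = zero_functor,
      mot_i = (\<lambda>S z. z),
      mot_q = (\<lambda>S z. ()),
      mot_u = incl_map ((Gm2 B)\<lparr>carrier := \<Gamma>\<rparr>)\<rparr>"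


section \<open>The groups\<close>

definition Z_inv :: "nat set \<Rightarrow> rat ring" where
  "Z_inv \<Sigma> =
     \<lparr>carrier = {of_int a / of_nat b | a b. b > 0 \<and> prime_factors b \<subseteq> \<Sigma>},
      monoid.mult = (*), one = 1, ring.zero = 0, add = (+)\<rparr>"

definition F_p :: "nat \<Rightarrow> int ring" where
  "F_p q = residue_ring (int q)"

definition reduce :: "nat \<Rightarrow> rat \<Rightarrow> int" where
  "reduce q x =
     (fst (quotient_of x) mod int q) \<otimes>\<^bsub>F_p q\<^esub> inv\<^bsub>F_p q\<^esub> (snd (quotient_of x) mod int q)"

definition r_p :: "nat \<Rightarrow> rat \<times> rat \<Rightarrow> int \<times> int" where
  "r_p q x = (reduce q (fst x), reduce q (snd x))"

definition zpowers :: "'g monoid \<Rightarrow> 'g \<Rightarrow> 'g set" where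
  "zpowers G a = {a [^]\<^bsub>G\<^esub> (k::int) | k. True}"

definition subgroup_prod :: "'g monoid \<Rightarrow> 'g set list \<Rightarrow> 'g set" where
  "subgroup_prod G Hs = foldr (\<lambda>H K. H <#>\<^bsub>G\<^esub> K) Hs {\<one>\<^bsub>G\<^esub>}"

text \<open>In what follows \<open>p i j\<close> stands for \<open>p\<^sub>i\<^sub>j\<close>.\<close>

definition S_set :: "(nat \<Rightarrow> nat \<Rightarrow> nat) \<Rightarrow> (nat \<Rightarrow> nat) \<Rightarrow> nat \<Rightarrow> nat set" where
  "S_set p n j = (\<lambda>i. p i j) ` {1..n j}"

definition Sigma_set :: "(nat \<Rightarrow> nat \<Rightarrow> nat) \<Rightarrow> (nat \<Rightarrow> nat) \<Rightarrow> nat \<Rightarrow> nat set" where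
  "Sigma_set p n t = (\<Union>j \<in> {1..t}. S_set p n j)"

definition ambient :: "(nat \<Rightarrow> nat \<Rightarrow> nat) \<Rightarrow> (nat \<Rightarrow> nat) \<Rightarrow> nat \<Rightarrow> (rat \<times> rat) monoid" where
  "ambient p n t = Gm2 (Z_inv (Sigma_set p n t))"

definition lam_first :: "(nat \<Rightarrow> nat \<Rightarrow> nat) \<Rightarrow> (nat \<Rightarrow> nat) \<Rightarrow> nat \<Rightarrow> rat \<times> rat" where
  "lam_first p N j = (1, of_nat (p 1 j) ^ N j)"

definition lam_last ::
    "(nat \<Rightarrow> nat \<Rightarrow> nat) \<Rightarrow> (nat \<Rightarrow> nat) \<Rightarrow> (nat \<Rightarrow> nat) \<Rightarrow> nat \<Rightarrow> rat \<times> rat" where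
  "lam_last p n N' j = (of_nat (p (n j) j) ^ N' j, 1)"

definition lam :: "(nat \<Rightarrow> nat \<Rightarrow> nat) \<Rightarrow> (nat \<Rightarrow> nat) \<Rightarrow> nat \<Rightarrow> nat \<Rightarrow> rat \<times> rat" where
  "lam p n i j =
     (if i = 1 then (of_nat (p 1 j), 1)
      else if i \<le> n j then (of_nat (p i j), of_nat (p (i - 1) j))
      else (1, of_nat (p (n j) j)))"

definition M_grp ::
    "(nat \<Rightarrow> nat \<Rightarrow> nat) \<Rightarrow> (nat \<Rightarrow> nat) \<Rightarrow> nat \<Rightarrow> nat \<Rightarrow> (rat \<times> rat) set" where
  "M_grp p n t j =
     subgroup_prod (ambient p n t)
       (map (\<lambda>i. zpowers (ambient p n t) (lam p n i j)) [1..<n j + 2])"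

text \<open>
  For disjoint \<open>T\<^sub>1\<close>, \<open>T\<^sub>2\<close> the factor \<open>\<lambda>\<^sub>j\<close> is missing from \<open>\<Lambda>\<^sub>j\<close> exactly when
  \<open>j \<in> T\<^sub>2\<close>, and the factor \<open>\<lambda>\<^sub>j'\<close> is missing from \<open>\<Lambda>\<^sub>j'\<close> exactly when \<open>j \<in> T\<^sub>1\<close>.
\<close>

definition Lam_grp ::
    "(nat \<Rightarrow> nat \<Rightarrow> nat) \<Rightarrow> (nat \<Rightarrow> nat) \<Rightarrow> (nat \<Rightarrow> nat) \<Rightarrow> nat set \<Rightarrow>
     nat \<Rightarrow> nat \<Rightarrow> (rat \<times> rat) set" where
  "Lam_grp p n N T2 t j =
     (if j \<in> T2 then M_grp p n t j
      else zpowers (ambient p n t) (lam_first p N j) <#>\<^bsub>ambient p n t\<^esub> M_grp p n t j)"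

definition Lam_grp' ::
    "(nat \<Rightarrow> nat \<Rightarrow> nat) \<Rightarrow> (nat \<Rightarrow> nat) \<Rightarrow> (nat \<Rightarrow> nat) \<Rightarrow> nat set \<Rightarrow>
     nat \<Rightarrow> nat \<Rightarrow> (rat \<times> rat) set" where
  "Lam_grp' p n N' T1 t j =
     (if j \<in> T1 then M_grp p n t j
      else M_grp p n t j <#>\<^bsub>ambient p n t\<^esub> zpowers (ambient p n t) (lam_last p n N' j))"

definition Gam ::
    "(nat \<Rightarrow> nat \<Rightarrow> nat) \<Rightarrow> (nat \<Rightarrow> nat) \<Rightarrow> (nat \<Rightarrow> nat) \<Rightarrow> nat set \<Rightarrow> nat \<Rightarrow>
     (rat \<times> rat) set" where
  "Gam p n N T2 t = subgroup_prod (ambient p n t) (map (Lam_grp p n N T2 t) [1..<t + 1])"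

definition Gam' ::
    "(nat \<Rightarrow> nat \<Rightarrow> nat) \<Rightarrow> (nat \<Rightarrow> nat) \<Rightarrow> (nat \<Rightarrow> nat) \<Rightarrow> nat set \<Rightarrow> nat \<Rightarrow>
     (rat \<times> rat) set" where
  "Gam' p n N' T1 t = subgroup_prod (ambient p n t) (map (Lam_grp' p n N' T1 t) [1..<t + 1])"


section \<open>The diagrams are diagrams of group functors\<close>

locale plain_cring = cring R for R :: "'r ring" (structure)
begin

lemma partition_eqI:
  assumes "finite A" "e \<in> A \<rightarrow> carrier R" "finsum R e A = \<one>"
    and "x \<in> carrier R" "y \<in> carrier R"
    and "\<And>a. a \<in> A \<Longrightarrow> e a \<otimes> x = e a \<otimes> y"
  shows "x = y"
proof -
  have "x = finsum R e A \<otimes> x" using assms by simp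
  also have "\<dots> = finsum R (\<lambda>a. e a \<otimes> x) A" using assms by (intro finsum_ldistr)
  also have "\<dots> = finsum R (\<lambda>a. e a \<otimes> y) A"
    using assms by (intro finsum_cong') (auto simp: Pi_iff)
  also have "\<dots> = finsum R e A \<otimes> y" using assms by (intro finsum_ldistr[symmetric])
  also have "\<dots> = y" using assms by simp
  finally show ?thesis .
qed

lemma suppD: "g \<in> carrier G \<Longrightarrow> g \<notin> supp G R e \<Longrightarrow> e g = \<zero>"
  by (simp add: supp_def)

lemma supp_carrier: "g \<in> supp G R e \<Longrightarrow> g \<in> carrier G"
  by (simp add: supp_def)

lemma const_memD:
  assumes "e \<in> carrier (const_sections G R)"
  shows "g \<in> carrier G \<Longrightarrow> e g \<in> carrier R"
    and "finite (supp G R e)"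
    and "g \<in> carrier G \<Longrightarrow> h \<in> carrier G \<Longrightarrow> g \<noteq> h \<Longrightarrow> e g \<otimes> e h = \<zero>"
    and "finsum R e (supp G R e) = \<one>"
    and "e \<in> extensional (carrier G)"
    and "e \<in> supp G R e \<rightarrow> carrier R"
  using assms by (auto simp: const_sections_def supp_def PiE_iff)

lemma const_memI:
  assumes "e \<in> extensional (carrier G)" "\<And>g. g \<in> carrier G \<Longrightarrow> e g \<in> carrier R"
    and "finite (supp G R e)"
    and "\<And>g h. g \<in> carrier G \<Longrightarrow> h \<in> carrier G \<Longrightarrow> g \<noteq> h \<Longrightarrow> e g \<otimes> e h = \<zero>"
    and "finsum R e (supp G R e) = \<one>"
  shows "e \<in> carrier (const_sections G R)"
  using assms by (auto simp: const_sections_def PiE_iff)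

lemma const_eqI:
  assumes "e \<in> carrier (const_sections G R)" "x \<in> carrier R" "y \<in> carrier R"
    and "\<And>a. a \<in> carrier G \<Longrightarrow> e a \<otimes> x = e a \<otimes> y"
  shows "x = y"
  using const_memD[OF assms(1)] assms(2-)
  by (intro partition_eqI[of "supp G R e" e x y]) (auto simp: supp_carrier)

lemma const_idem:
  assumes e: "e \<in> carrier (const_sections G R)" and a: "a \<in> carrier G"
  shows "e a \<otimes> e a = e a"
proof (cases "a \<in> supp G R e")
  case False
  then show ?thesis using suppD[OF a False] by simp
next
  case True
  note D = const_memD[OF e]
  have "e a = e a \<otimes> finsum R e (supp G R e)" using D a by simp
  also have "\<dots> = finsum R (\<lambda>g. e a \<otimes> e g) (supp G R e)"
    by (rule finsum_rdistr) (use D a in auto)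
  also have "\<dots> = finsum R (\<lambda>g. if a = g then e a \<otimes> e a else \<zero>) (supp G R e)"
    using D a by (intro finsum_cong') (auto simp: supp_carrier)
  also have "\<dots> = e a \<otimes> e a"
    using finsum_singleton[OF True D(2), of "\<lambda>g. e a \<otimes> e a"] D a by auto
  finally show ?thesis by simp
qed

lemma const_mult_finsum:
  assumes e: "e \<in> carrier (const_sections G R)" and a: "a \<in> carrier G"
    and k: "\<And>g. g \<in> carrier G \<Longrightarrow> k g \<in> carrier R"
  shows "e a \<otimes> finsum R (\<lambda>g. e g \<otimes> k g) (supp G R e) = e a \<otimes> k a"
proof (cases "a \<in> supp G R e")
  case False
  then have "e a = \<zero>" using a by (rule suppD[rotated])
  moreover have "finsum R (\<lambda>g. e g \<otimes> k g) (supp G R e) \<in> carrier R"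
    using const_memD[OF e] k by (intro finsum_closed) (auto simp: supp_carrier)
  ultimately show ?thesis using k a by simp
next
  case True
  note D = const_memD[OF e]
  note idem = const_idem[OF e a]
  have "e a \<otimes> finsum R (\<lambda>g. e g \<otimes> k g) (supp G R e)
      = finsum R (\<lambda>g. e a \<otimes> (e g \<otimes> k g)) (supp G R e)"
    using D a k by (intro finsum_rdistr) (auto simp: supp_carrier)
  also have "\<dots> = finsum R (\<lambda>g. if a = g then e a \<otimes> k a else \<zero>) (supp G R e)"
  proof (intro finsum_cong')
    fix g assume "g \<in> supp G R e"
    then have g: "g \<in> carrier G" by (rule supp_carrier)
    have "e a \<otimes> (e g \<otimes> k g) = (e a \<otimes> e g) \<otimes> k g"
      using D a k g by (simp add: m_assoc)
    then show "e a \<otimes> (e g \<otimes> k g) = (if a = g then e a \<otimes> k a else \<zero>)"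
      using D(3)[of a g] idem a g k by auto
  qed (use D a k in auto)
  also have "\<dots> = e a \<otimes> k a"
    using finsum_singleton[OF True D(2), of "\<lambda>g. e a \<otimes> k a"] D a k by auto
  finally show ?thesis .
qed

lemma const_delta:
  assumes "e \<in> carrier (const_sections G R)" "a \<in> carrier G" "b \<in> carrier G"
  shows "e a \<otimes> e b = (if a = b then e a else \<zero>)"
  using const_idem[OF assms(1,2)] const_memD(3)[OF assms] by auto

lemma const_ext:
  assumes "e \<in> carrier (const_sections G R)" "f \<in> carrier (const_sections G R)"
    and "\<And>g. g \<in> carrier G \<Longrightarrow> e g = f g"
  shows "e = f"
  using const_memD(5)[OF assms(1)] const_memD(5)[OF assms(2)] assms(3)
  by (rule extensionalityI)

end

lemma const_one_mem_aux:
  fixes G :: "'g monoid" and R :: "'r ring"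
  assumes "monoid G" "cring R"
  shows "(\<lambda>g \<in> carrier G. if g = \<one>\<^bsub>G\<^esub> then \<one>\<^bsub>R\<^esub> else \<zero>\<^bsub>R\<^esub>) \<in> carrier (const_sections G R)"
    (is "?d \<in> _")
proof -
  interpret R: plain_cring R using assms(2) by (rule plain_cring.intro)
  interpret G: monoid G by fact
  show ?thesis
  proof (rule R.const_memI)
    have sub: "supp G R ?d \<subseteq> {\<one>\<^bsub>G\<^esub>}" by (auto simp: supp_def split: if_splits)
    then show "finite (supp G R ?d)" by (rule finite_subset) simp
    have "finsum R ?d (supp G R ?d) = finsum R ?d {\<one>\<^bsub>G\<^esub>}"
      by (rule R.add.finprod_mono_neutral_cong_left) (use sub in \<open>auto simp: supp_def\<close>)
    also have "\<dots> = \<one>\<^bsub>R\<^esub>" by (subst R.finsum_insert) auto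
    finally show "finsum R ?d (supp G R ?d) = \<one>\<^bsub>R\<^esub>" .
  qed auto
qed

locale const_setup = G: comm_group G + R: plain_cring R
  for G :: "'g monoid" and R :: "'r ring"
begin

abbreviation "C \<equiv> const_sections G R"

lemma conv_apply:
  "c \<in> carrier G \<Longrightarrow> (e \<otimes>\<^bsub>C\<^esub> f) c
     = finsum R (\<lambda>a. e a \<otimes>\<^bsub>R\<^esub> f (inv\<^bsub>G\<^esub> a \<otimes>\<^bsub>G\<^esub> c)) (supp G R e)"
  by (simp add: const_sections_def)

lemma conv_ext: "(e \<otimes>\<^bsub>C\<^esub> f) \<in> extensional (carrier G)"
  by (simp add: const_sections_def)

lemma conv_closed_R:
  assumes "e \<in> carrier C" "f \<in> carrier C" "c \<in> carrier G"
  shows "(e \<otimes>\<^bsub>C\<^esub> f) c \<in> carrier R"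
  unfolding conv_apply[OF assms(3)]
  using R.const_memD(1)[OF assms(1)] R.const_memD(1)[OF assms(2)] assms(3)
  by (intro R.finsum_closed) (auto simp: supp_def)

lemma conv_local:
  assumes "e \<in> carrier C" "f \<in> carrier C" "a \<in> carrier G" "b \<in> carrier G" "c \<in> carrier G"
  shows "(e a \<otimes>\<^bsub>R\<^esub> f b) \<otimes>\<^bsub>R\<^esub> (e \<otimes>\<^bsub>C\<^esub> f) c
    = (if c = a \<otimes>\<^bsub>G\<^esub> b then e a \<otimes>\<^bsub>R\<^esub> f b else \<zero>\<^bsub>R\<^esub>)"
proof -
  note De = R.const_memD(1)[OF assms(1)] and Df = R.const_memD(1)[OF assms(2)]
  have "(e a \<otimes>\<^bsub>R\<^esub> f b) \<otimes>\<^bsub>R\<^esub> (e \<otimes>\<^bsub>C\<^esub> f) c = f b \<otimes>\<^bsub>R\<^esub> (e a \<otimes>\<^bsub>R\<^esub> (e \<otimes>\<^bsub>C\<^esub> f) c)"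
    using De Df assms conv_closed_R[OF assms(1,2,5)] by (simp add: R.m_ac)
  also have "e a \<otimes>\<^bsub>R\<^esub> (e \<otimes>\<^bsub>C\<^esub> f) c = e a \<otimes>\<^bsub>R\<^esub> f (inv\<^bsub>G\<^esub> a \<otimes>\<^bsub>G\<^esub> c)"
    unfolding conv_apply[OF assms(5)]
    by (rule R.const_mult_finsum) (use assms Df in auto)
  also have "f b \<otimes>\<^bsub>R\<^esub> (e a \<otimes>\<^bsub>R\<^esub> f (inv\<^bsub>G\<^esub> a \<otimes>\<^bsub>G\<^esub> c))
      = e a \<otimes>\<^bsub>R\<^esub> (f b \<otimes>\<^bsub>R\<^esub> f (inv\<^bsub>G\<^esub> a \<otimes>\<^bsub>G\<^esub> c))"
    using De Df assms by (simp add: R.m_ac)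
  also have "\<dots> = (if b = inv\<^bsub>G\<^esub> a \<otimes>\<^bsub>G\<^esub> c then e a \<otimes>\<^bsub>R\<^esub> f b else \<zero>\<^bsub>R\<^esub>)"
    using R.const_delta[OF assms(2,4), of "inv\<^bsub>G\<^esub> a \<otimes>\<^bsub>G\<^esub> c"] De Df assms by auto
  also have "b = inv\<^bsub>G\<^esub> a \<otimes>\<^bsub>G\<^esub> c \<longleftrightarrow> c = a \<otimes>\<^bsub>G\<^esub> b"
    using assms by (metis G.inv_solve_left)
  finally show ?thesis .
qed

text \<open>Two elements agree if they agree on each piece \<open>e = a\<close>, \<open>f = b\<close>.\<close>

lemma conv_eqI:
  assumes e: "e \<in> carrier C" and f: "f \<in> carrier C" and xy: "x \<in> carrier R" "y \<in> carrier R"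
    and eq: "\<And>a b. a \<in> carrier G \<Longrightarrow> b \<in> carrier G \<Longrightarrow>
      (e a \<otimes>\<^bsub>R\<^esub> f b) \<otimes>\<^bsub>R\<^esub> x = (e a \<otimes>\<^bsub>R\<^esub> f b) \<otimes>\<^bsub>R\<^esub> y"
  shows "x = y"
proof (rule R.const_eqI[OF e xy])
  fix a assume a: "a \<in> carrier G"
  show "e a \<otimes>\<^bsub>R\<^esub> x = e a \<otimes>\<^bsub>R\<^esub> y"
  proof (rule R.const_eqI[OF f])
    fix b assume b: "b \<in> carrier G"
    show "f b \<otimes>\<^bsub>R\<^esub> (e a \<otimes>\<^bsub>R\<^esub> x) = f b \<otimes>\<^bsub>R\<^esub> (e a \<otimes>\<^bsub>R\<^esub> y)"
      using eq[OF a b] a b xy R.const_memD(1)[OF e] R.const_memD(1)[OF f]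
      by (simp add: R.m_ac)
  qed (use a xy R.const_memD(1)[OF e] in auto)
qed

lemma conv_closed:
  assumes e: "e \<in> carrier C" and f: "f \<in> carrier C"
  shows "e \<otimes>\<^bsub>C\<^esub> f \<in> carrier C"
proof (rule R.const_memI)
  let ?h = "e \<otimes>\<^bsub>C\<^esub> f"
  note De = R.const_memD(1)[OF e] and Df = R.const_memD(1)[OF f] and Dh = conv_closed_R[OF e f]
  show "?h \<in> extensional (carrier G)" by (rule conv_ext)
  show "?h g \<in> carrier R" if "g \<in> carrier G" for g using conv_closed_R[OF e f that] .
  have "supp G R ?h \<subseteq> (\<lambda>(a, b). a \<otimes>\<^bsub>G\<^esub> b) ` (supp G R e \<times> supp G R f)"
  proof (rule ccontr)
    assume "\<not> ?thesis"
    then obtain c where c: "c \<in> carrier G" "?h c \<noteq> \<zero>\<^bsub>R\<^esub>"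
      and nc: "\<And>a b. a \<in> supp G R e \<Longrightarrow> b \<in> supp G R f \<Longrightarrow> c \<noteq> a \<otimes>\<^bsub>G\<^esub> b"
      by (auto simp: supp_def image_iff)
    have "?h c = \<zero>\<^bsub>R\<^esub>"
    proof (rule conv_eqI[OF e f])
      fix a b assume ab: "a \<in> carrier G" "b \<in> carrier G"
      show "(e a \<otimes>\<^bsub>R\<^esub> f b) \<otimes>\<^bsub>R\<^esub> ?h c = (e a \<otimes>\<^bsub>R\<^esub> f b) \<otimes>\<^bsub>R\<^esub> \<zero>\<^bsub>R\<^esub>"
        using conv_local[OF e f ab c(1)] nc[of a b] De[OF ab(1)] Df[OF ab(2)] ab
        by (cases "e a = \<zero>\<^bsub>R\<^esub> \<or> f b = \<zero>\<^bsub>R\<^esub>") (auto simp: supp_def)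
    qed (use Dh c in auto)
    with c show False by simp
  qed
  then show fin: "finite (supp G R ?h)"
    by (rule finite_subset) (use R.const_memD(2)[OF e] R.const_memD(2)[OF f] in simp)
  show "?h c \<otimes>\<^bsub>R\<^esub> ?h d = \<zero>\<^bsub>R\<^esub>" if cd: "c \<in> carrier G" "d \<in> carrier G" "c \<noteq> d" for c d
  proof (rule conv_eqI[OF e f])
    fix a b assume ab: "a \<in> carrier G" "b \<in> carrier G"
    have "(e a \<otimes>\<^bsub>R\<^esub> f b) \<otimes>\<^bsub>R\<^esub> (?h c \<otimes>\<^bsub>R\<^esub> ?h d) = ((e a \<otimes>\<^bsub>R\<^esub> f b) \<otimes>\<^bsub>R\<^esub> ?h c) \<otimes>\<^bsub>R\<^esub> ?h d"
      using De Df Dh ab cd by (simp add: R.m_assoc)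
    also have "\<dots> = \<zero>\<^bsub>R\<^esub>"
      using conv_local[OF e f ab cd(1)] conv_local[OF e f ab cd(2)] cd Dh[OF cd(2)] by auto
    finally show "(e a \<otimes>\<^bsub>R\<^esub> f b) \<otimes>\<^bsub>R\<^esub> (?h c \<otimes>\<^bsub>R\<^esub> ?h d) = (e a \<otimes>\<^bsub>R\<^esub> f b) \<otimes>\<^bsub>R\<^esub> \<zero>\<^bsub>R\<^esub>"
      using De Df ab by simp
  qed (use Dh cd in auto)
  have hc: "?h \<in> supp G R ?h \<rightarrow> carrier R" using Dh by (auto simp: supp_def)
  show "finsum R ?h (supp G R ?h) = \<one>\<^bsub>R\<^esub>"
  proof (rule conv_eqI[OF e f])
    fix a b assume ab: "a \<in> carrier G" "b \<in> carrier G"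
    let ?p = "e a \<otimes>\<^bsub>R\<^esub> f b"
    have p: "?p \<in> carrier R" using De Df ab by simp
    have "?p \<otimes>\<^bsub>R\<^esub> finsum R ?h (supp G R ?h) = finsum R (\<lambda>c. ?p \<otimes>\<^bsub>R\<^esub> ?h c) (supp G R ?h)"
      using fin p hc by (rule R.finsum_rdistr)
    also have "\<dots> = finsum R (\<lambda>c. if a \<otimes>\<^bsub>G\<^esub> b = c then ?p else \<zero>\<^bsub>R\<^esub>) (supp G R ?h)"
      using conv_local[OF e f ab] p by (intro R.finsum_cong') (auto simp: supp_def)
    also have "\<dots> = ?p"
    proof (cases "a \<otimes>\<^bsub>G\<^esub> b \<in> supp G R ?h")
      case True
      show ?thesis using R.finsum_singleton[OF True fin, of "\<lambda>c. ?p"] p by auto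
    next
      case False
      then have "?h (a \<otimes>\<^bsub>G\<^esub> b) = \<zero>\<^bsub>R\<^esub>" using ab by (auto simp: supp_def)
      then have "?p = \<zero>\<^bsub>R\<^esub>"
        using conv_local[OF e f ab, of "a \<otimes>\<^bsub>G\<^esub> b"] ab p by simp
      then show ?thesis by (simp add: R.finsum_zero cong: if_cong)
    qed
    finally show "?p \<otimes>\<^bsub>R\<^esub> finsum R ?h (supp G R ?h) = ?p \<otimes>\<^bsub>R\<^esub> \<one>\<^bsub>R\<^esub>" using p by simp
  qed (use hc in auto)
qed

lemma conv_eqI':
  assumes e: "e \<in> carrier C" and f: "f \<in> carrier C" and h: "h \<in> carrier C"
    and eq: "\<And>a b c. a \<in> carrier G \<Longrightarrow> b \<in> carrier G \<Longrightarrow> c \<in> carrier G \<Longrightarrow>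
      (e a \<otimes>\<^bsub>R\<^esub> f b) \<otimes>\<^bsub>R\<^esub> h c = (if c = a \<otimes>\<^bsub>G\<^esub> b then e a \<otimes>\<^bsub>R\<^esub> f b else \<zero>\<^bsub>R\<^esub>)"
  shows "e \<otimes>\<^bsub>C\<^esub> f = h"
proof (rule R.const_ext[OF conv_closed[OF e f] h])
  fix c assume c: "c \<in> carrier G"
  show "(e \<otimes>\<^bsub>C\<^esub> f) c = h c"
    by (rule conv_eqI[OF e f])
      (use c e f h eq conv_local conv_closed_R R.const_memD(1)[OF h] in auto)
qed

lemma const_one_mem: "\<one>\<^bsub>C\<^esub> \<in> carrier C"
  using const_one_mem_aux[OF G.monoid_axioms R.cring_axioms] by (simp add: const_sections_def)

lemma const_one_apply:
  "g \<in> carrier G \<Longrightarrow> \<one>\<^bsub>C\<^esub> g = (if g = \<one>\<^bsub>G\<^esub> then \<one>\<^bsub>R\<^esub> else \<zero>\<^bsub>R\<^esub>)"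
  by (simp add: const_sections_def)

lemma const_inv_mem:
  assumes e: "e \<in> carrier C"
  shows "(\<lambda>g \<in> carrier G. e (inv\<^bsub>G\<^esub> g)) \<in> carrier C"
proof (rule R.const_memI)
  let ?f = "\<lambda>g \<in> carrier G. e (inv\<^bsub>G\<^esub> g)"
  note D = R.const_memD[OF e]
  have eq: "supp G R ?f = (\<lambda>g. inv\<^bsub>G\<^esub> g) ` supp G R e"
  proof (intro equalityI subsetI)
    fix g assume "g \<in> supp G R ?f"
    then have "inv\<^bsub>G\<^esub> g \<in> supp G R e" "g = inv\<^bsub>G\<^esub> (inv\<^bsub>G\<^esub> g)" by (auto simp: supp_def)
    then show "g \<in> (\<lambda>g. inv\<^bsub>G\<^esub> g) ` supp G R e" by blast
  qed (auto simp: supp_def)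
  have inj: "inj_on (\<lambda>g. inv\<^bsub>G\<^esub> g) (supp G R e)"
    by (auto simp: supp_def intro!: inj_onI dest: G.inv_inj[THEN inj_onD])
  show "finite (supp G R ?f)" unfolding eq using D(2) by simp
  have "finsum R ?f (supp G R ?f) = finsum R (\<lambda>g. ?f (inv\<^bsub>G\<^esub> g)) (supp G R e)"
    unfolding eq by (rule R.finsum_reindex) (use inj D in \<open>auto simp: supp_def\<close>)
  also have "\<dots> = finsum R e (supp G R e)"
    using D by (intro R.finsum_cong') (auto simp: supp_def)
  finally show "finsum R ?f (supp G R ?f) = \<one>\<^bsub>R\<^esub>" using D(4) by simp
  show "?f g \<otimes>\<^bsub>R\<^esub> ?f h = \<zero>\<^bsub>R\<^esub>" if "g \<in> carrier G" "h \<in> carrier G" "g \<noteq> h" for g h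
    using that D(3)[of "inv\<^bsub>G\<^esub> g" "inv\<^bsub>G\<^esub> h"] inj_onD[OF G.inv_inj, of g h]
    by (metis G.inv_closed restrict_apply')
qed (use R.const_memD(1)[OF e] in auto)

lemma const_comm_group: "comm_group C"
proof (rule comm_groupI)
  fix e f assume e: "e \<in> carrier C" and f: "f \<in> carrier C"
  note De = R.const_memD(1)[OF e] and Df = R.const_memD(1)[OF f]
  show "e \<otimes>\<^bsub>C\<^esub> f \<in> carrier C" using e f by (rule conv_closed)
  show "e \<otimes>\<^bsub>C\<^esub> f = f \<otimes>\<^bsub>C\<^esub> e"
  proof (rule conv_eqI'[OF e f conv_closed[OF f e]])
    fix a b c assume abc: "a \<in> carrier G" "b \<in> carrier G" "c \<in> carrier G"
    show "(e a \<otimes>\<^bsub>R\<^esub> f b) \<otimes>\<^bsub>R\<^esub> (f \<otimes>\<^bsub>C\<^esub> e) c = (if c = a \<otimes>\<^bsub>G\<^esub> b then e a \<otimes>\<^bsub>R\<^esub> f b else \<zero>\<^bsub>R\<^esub>)"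
      using conv_local[OF f e abc(2,1,3)] abc De Df by (simp add: R.m_comm G.m_comm)
  qed
next
  fix e f g assume e: "e \<in> carrier C" and f: "f \<in> carrier C" and g: "g \<in> carrier C"
  note De = R.const_memD(1)[OF e] and Df = R.const_memD(1)[OF f] and Dg = R.const_memD(1)[OF g]
  note ef = conv_closed[OF e f] and fg = conv_closed[OF f g]
  show "e \<otimes>\<^bsub>C\<^esub> f \<otimes>\<^bsub>C\<^esub> g = e \<otimes>\<^bsub>C\<^esub> (f \<otimes>\<^bsub>C\<^esub> g)"
  proof (rule R.const_ext[OF conv_closed[OF ef g] conv_closed[OF e fg]])
    fix d assume d: "d \<in> carrier G"
    let ?l = "(e \<otimes>\<^bsub>C\<^esub> f \<otimes>\<^bsub>C\<^esub> g) d" and ?r = "(e \<otimes>\<^bsub>C\<^esub> (f \<otimes>\<^bsub>C\<^esub> g)) d"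
    have l: "?l \<in> carrier R" and r: "?r \<in> carrier R"
      using conv_closed_R[OF ef g d] conv_closed_R[OF e fg d] by auto
    show "?l = ?r"
    proof (rule conv_eqI[OF e f l r])
      fix a b assume ab: "a \<in> carrier G" "b \<in> carrier G"
      let ?p = "e a \<otimes>\<^bsub>R\<^esub> f b"
      have p: "?p \<in> carrier R" using De Df ab by simp
      show "?p \<otimes>\<^bsub>R\<^esub> ?l = ?p \<otimes>\<^bsub>R\<^esub> ?r"
      proof (rule R.const_eqI[OF g])
        fix c assume c: "c \<in> carrier G"
        let ?x = "(e \<otimes>\<^bsub>C\<^esub> f) (a \<otimes>\<^bsub>G\<^esub> b)" and ?y = "(f \<otimes>\<^bsub>C\<^esub> g) (b \<otimes>\<^bsub>G\<^esub> c)"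
        have x: "?x \<in> carrier R" and y: "?y \<in> carrier R"
          using conv_closed_R[OF e f] conv_closed_R[OF f g] ab c by auto
        have px: "?p \<otimes>\<^bsub>R\<^esub> ?x = ?p" using conv_local[OF e f ab, of "a \<otimes>\<^bsub>G\<^esub> b"] ab by simp
        have py: "f b \<otimes>\<^bsub>R\<^esub> g c \<otimes>\<^bsub>R\<^esub> ?y = f b \<otimes>\<^bsub>R\<^esub> g c"
          using conv_local[OF f g ab(2) c, of "b \<otimes>\<^bsub>G\<^esub> c"] ab c by simp
        have "g c \<otimes>\<^bsub>R\<^esub> (?p \<otimes>\<^bsub>R\<^esub> ?l) = g c \<otimes>\<^bsub>R\<^esub> (?p \<otimes>\<^bsub>R\<^esub> ?x \<otimes>\<^bsub>R\<^esub> ?l)" by (simp only: px)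
        also have "\<dots> = ?p \<otimes>\<^bsub>R\<^esub> (?x \<otimes>\<^bsub>R\<^esub> g c \<otimes>\<^bsub>R\<^esub> ?l)"
          using p x l Dg[OF c] by (simp add: R.m_ac del: px)
        also have "?x \<otimes>\<^bsub>R\<^esub> g c \<otimes>\<^bsub>R\<^esub> ?l
            = (if d = a \<otimes>\<^bsub>G\<^esub> b \<otimes>\<^bsub>G\<^esub> c then ?x \<otimes>\<^bsub>R\<^esub> g c else \<zero>\<^bsub>R\<^esub>)"
          using conv_local[OF ef g, of "a \<otimes>\<^bsub>G\<^esub> b" c d] ab c d by simp
        also have "?p \<otimes>\<^bsub>R\<^esub> \<dots> = (if d = a \<otimes>\<^bsub>G\<^esub> b \<otimes>\<^bsub>G\<^esub> c then (?p \<otimes>\<^bsub>R\<^esub> ?x) \<otimes>\<^bsub>R\<^esub> g c else \<zero>\<^bsub>R\<^esub>)"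
          using p x Dg[OF c] by (simp add: R.m_assoc)
        finally have L: "g c \<otimes>\<^bsub>R\<^esub> (?p \<otimes>\<^bsub>R\<^esub> ?l)
            = (if d = a \<otimes>\<^bsub>G\<^esub> b \<otimes>\<^bsub>G\<^esub> c then ?p \<otimes>\<^bsub>R\<^esub> g c else \<zero>\<^bsub>R\<^esub>)" by (simp only: px)
        have "g c \<otimes>\<^bsub>R\<^esub> (?p \<otimes>\<^bsub>R\<^esub> ?r) = e a \<otimes>\<^bsub>R\<^esub> (f b \<otimes>\<^bsub>R\<^esub> g c) \<otimes>\<^bsub>R\<^esub> ?r"
          using De[OF ab(1)] Df[OF ab(2)] r Dg[OF c] by (simp add: R.m_ac)
        also have "\<dots> = e a \<otimes>\<^bsub>R\<^esub> (f b \<otimes>\<^bsub>R\<^esub> g c \<otimes>\<^bsub>R\<^esub> ?y) \<otimes>\<^bsub>R\<^esub> ?r" by (simp only: py)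
        also have "\<dots> = (f b \<otimes>\<^bsub>R\<^esub> g c) \<otimes>\<^bsub>R\<^esub> (e a \<otimes>\<^bsub>R\<^esub> ?y \<otimes>\<^bsub>R\<^esub> ?r)"
          using De[OF ab(1)] Df[OF ab(2)] y r Dg[OF c] by (simp add: R.m_ac)
        also have "e a \<otimes>\<^bsub>R\<^esub> ?y \<otimes>\<^bsub>R\<^esub> ?r
            = (if d = a \<otimes>\<^bsub>G\<^esub> (b \<otimes>\<^bsub>G\<^esub> c) then e a \<otimes>\<^bsub>R\<^esub> ?y else \<zero>\<^bsub>R\<^esub>)"
          using conv_local[OF e fg, of a "b \<otimes>\<^bsub>G\<^esub> c" d] ab c d by simp
        also have "(f b \<otimes>\<^bsub>R\<^esub> g c) \<otimes>\<^bsub>R\<^esub> \<dots>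
            = (if d = a \<otimes>\<^bsub>G\<^esub> (b \<otimes>\<^bsub>G\<^esub> c) then e a \<otimes>\<^bsub>R\<^esub> (f b \<otimes>\<^bsub>R\<^esub> g c \<otimes>\<^bsub>R\<^esub> ?y) else \<zero>\<^bsub>R\<^esub>)"
          using De[OF ab(1)] Df[OF ab(2)] y Dg[OF c] by (simp add: R.m_ac)
        finally have Rr: "g c \<otimes>\<^bsub>R\<^esub> (?p \<otimes>\<^bsub>R\<^esub> ?r)
            = (if d = a \<otimes>\<^bsub>G\<^esub> (b \<otimes>\<^bsub>G\<^esub> c) then e a \<otimes>\<^bsub>R\<^esub> (f b \<otimes>\<^bsub>R\<^esub> g c) else \<zero>\<^bsub>R\<^esub>)"
          by (simp only: py)
        show "g c \<otimes>\<^bsub>R\<^esub> (?p \<otimes>\<^bsub>R\<^esub> ?l) = g c \<otimes>\<^bsub>R\<^esub> (?p \<otimes>\<^bsub>R\<^esub> ?r)"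
          unfolding L Rr using ab c De[OF ab(1)] Df[OF ab(2)] Dg[OF c]
          by (simp add: G.m_assoc R.m_assoc)
      qed (use p l r in auto)
    qed
  qed
next
  show "\<one>\<^bsub>C\<^esub> \<in> carrier C" by (rule const_one_mem)
next
  fix e assume e: "e \<in> carrier C"
  note D = R.const_memD(1)[OF e]
  show "\<one>\<^bsub>C\<^esub> \<otimes>\<^bsub>C\<^esub> e = e"
  proof (rule conv_eqI'[OF const_one_mem e e])
    fix a b c assume abc: "a \<in> carrier G" "b \<in> carrier G" "c \<in> carrier G"
    show "(\<one>\<^bsub>C\<^esub> a \<otimes>\<^bsub>R\<^esub> e b) \<otimes>\<^bsub>R\<^esub> e c = (if c = a \<otimes>\<^bsub>G\<^esub> b then \<one>\<^bsub>C\<^esub> a \<otimes>\<^bsub>R\<^esub> e b else \<zero>\<^bsub>R\<^esub>)"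
      using R.const_delta[OF e abc(2,3)] D abc by (auto simp: const_one_apply)
  qed
  let ?f = "\<lambda>g \<in> carrier G. e (inv\<^bsub>G\<^esub> g)"
  have "?f \<otimes>\<^bsub>C\<^esub> e = \<one>\<^bsub>C\<^esub>"
  proof (rule conv_eqI'[OF const_inv_mem[OF e] e const_one_mem])
    fix a b c assume abc: "a \<in> carrier G" "b \<in> carrier G" "c \<in> carrier G"
    have 1: "?f a \<otimes>\<^bsub>R\<^esub> e b = (if inv\<^bsub>G\<^esub> a = b then e b else \<zero>\<^bsub>R\<^esub>)"
      using R.const_delta[OF e, of "inv\<^bsub>G\<^esub> a" b] abc by auto
    show "(?f a \<otimes>\<^bsub>R\<^esub> e b) \<otimes>\<^bsub>R\<^esub> \<one>\<^bsub>C\<^esub> c = (if c = a \<otimes>\<^bsub>G\<^esub> b then ?f a \<otimes>\<^bsub>R\<^esub> e b else \<zero>\<^bsub>R\<^esub>)"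
      unfolding 1 using abc D by (auto simp: const_one_apply)
  qed
  then show "\<exists>f\<in>carrier C. f \<otimes>\<^bsub>C\<^esub> e = \<one>\<^bsub>C\<^esub>" using const_inv_mem[OF e] by blast
qed


definition glue :: "('g \<Rightarrow> 'r) \<Rightarrow> ('g \<Rightarrow> 'r) \<Rightarrow> 'r" where
  "glue k e = finsum R (\<lambda>g. e g \<otimes>\<^bsub>R\<^esub> k g) (supp G R e)"

lemma glue_closed:
  assumes e: "e \<in> carrier C" and k: "k \<in> carrier G \<rightarrow> carrier R"
  shows "glue k e \<in> carrier R"
  unfolding glue_def using R.const_memD(1)[OF e] k
  by (intro R.finsum_closed) (auto simp: supp_def)

lemma glue_local:
  assumes "e \<in> carrier C" "k \<in> carrier G \<rightarrow> carrier R" "a \<in> carrier G"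
  shows "e a \<otimes>\<^bsub>R\<^esub> glue k e = e a \<otimes>\<^bsub>R\<^esub> k a"
  unfolding glue_def by (rule R.const_mult_finsum) (use assms in auto)

lemma glue_mult:
  assumes e: "e \<in> carrier C" and f: "f \<in> carrier C" and k: "k \<in> carrier G \<rightarrow> carrier R"
    and mult: "\<And>a b. a \<in> carrier G \<Longrightarrow> b \<in> carrier G \<Longrightarrow> k (a \<otimes>\<^bsub>G\<^esub> b) = k a \<otimes>\<^bsub>R\<^esub> k b"
  shows "glue k (e \<otimes>\<^bsub>C\<^esub> f) = glue k e \<otimes>\<^bsub>R\<^esub> glue k f"
proof (rule conv_eqI[OF e f])
  let ?h = "e \<otimes>\<^bsub>C\<^esub> f"
  note De = R.const_memD(1)[OF e] and Df = R.const_memD(1)[OF f]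
  note h = conv_closed[OF e f]
  note cl = glue_closed[OF e k] glue_closed[OF f k] glue_closed[OF h k]
  fix a b assume ab: "a \<in> carrier G" "b \<in> carrier G"
  then have kab: "k a \<in> carrier R" "k b \<in> carrier R" "k (a \<otimes>\<^bsub>G\<^esub> b) \<in> carrier R"
    using k by auto
  let ?p = "e a \<otimes>\<^bsub>R\<^esub> f b" and ?x = "?h (a \<otimes>\<^bsub>G\<^esub> b)"
  have p: "?p \<in> carrier R" and x: "?x \<in> carrier R"
    using De Df ab R.const_memD(1)[OF h] by auto
  have px: "?p \<otimes>\<^bsub>R\<^esub> ?x = ?p" using conv_local[OF e f ab, of "a \<otimes>\<^bsub>G\<^esub> b"] ab by simp
  have "?p \<otimes>\<^bsub>R\<^esub> glue k ?h = ?p \<otimes>\<^bsub>R\<^esub> ?x \<otimes>\<^bsub>R\<^esub> glue k ?h" by (simp only: px)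
  also have "\<dots> = ?p \<otimes>\<^bsub>R\<^esub> (?x \<otimes>\<^bsub>R\<^esub> glue k ?h)" using p x cl by (simp add: R.m_assoc)
  also have "?x \<otimes>\<^bsub>R\<^esub> glue k ?h = ?x \<otimes>\<^bsub>R\<^esub> k (a \<otimes>\<^bsub>G\<^esub> b)" using glue_local[OF h k] ab by simp
  also have "?p \<otimes>\<^bsub>R\<^esub> \<dots> = ?p \<otimes>\<^bsub>R\<^esub> ?x \<otimes>\<^bsub>R\<^esub> k (a \<otimes>\<^bsub>G\<^esub> b)" using p x kab by (simp add: R.m_assoc)
  also have "\<dots> = (e a \<otimes>\<^bsub>R\<^esub> k a) \<otimes>\<^bsub>R\<^esub> (f b \<otimes>\<^bsub>R\<^esub> k b)"
    unfolding px mult[OF ab] using kab De[OF ab(1)] Df[OF ab(2)] by (simp add: R.m_ac)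
  also have "\<dots> = (e a \<otimes>\<^bsub>R\<^esub> glue k e) \<otimes>\<^bsub>R\<^esub> (f b \<otimes>\<^bsub>R\<^esub> glue k f)"
    using glue_local[OF e k ab(1)] glue_local[OF f k ab(2)] by simp
  also have "\<dots> = ?p \<otimes>\<^bsub>R\<^esub> (glue k e \<otimes>\<^bsub>R\<^esub> glue k f)"
    using cl De[OF ab(1)] Df[OF ab(2)] by (simp add: R.m_ac)
  finally show "?p \<otimes>\<^bsub>R\<^esub> glue k ?h = ?p \<otimes>\<^bsub>R\<^esub> (glue k e \<otimes>\<^bsub>R\<^esub> glue k f)" .
qed (use glue_closed[OF _ k] e f conv_closed in auto)

lemma glue_one:
  assumes k: "k \<in> carrier G \<rightarrow> carrier R" and "k \<one>\<^bsub>G\<^esub> = \<one>\<^bsub>R\<^esub>"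
  shows "glue k \<one>\<^bsub>C\<^esub> = \<one>\<^bsub>R\<^esub>"
  using glue_local[OF const_one_mem k, of "\<one>\<^bsub>G\<^esub>"] glue_closed[OF const_one_mem k] assms
  by (simp add: const_one_apply)

lemma glue_hom:
  assumes k: "k \<in> carrier G \<rightarrow> carrier R" and one: "k \<one>\<^bsub>G\<^esub> = \<one>\<^bsub>R\<^esub>"
    and mult: "\<And>a b. a \<in> carrier G \<Longrightarrow> b \<in> carrier G \<Longrightarrow> k (a \<otimes>\<^bsub>G\<^esub> b) = k a \<otimes>\<^bsub>R\<^esub> k b"
  shows "glue k \<in> hom C (units_of R)"
proof -
  interpret C: comm_group C by (rule const_comm_group)
  have "glue k e \<in> Units R" if e: "e \<in> carrier C" for e
  proof -
    have "glue k e \<otimes>\<^bsub>R\<^esub> glue k (inv\<^bsub>C\<^esub> e) = \<one>\<^bsub>R\<^esub>"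
      using glue_mult[OF e C.inv_closed[OF e] k mult] e glue_one[OF k one] by simp
    then show ?thesis
      using glue_closed[OF e k] glue_closed[OF C.inv_closed[OF e] k] R.m_comm
      by (auto simp: Units_def intro!: bexI[of _ "glue k (inv\<^bsub>C\<^esub> e)"])
  qed
  then show ?thesis
    by (auto simp: hom_def units_of_def glue_mult[OF _ _ k mult])
qed

lemma restr_mem:
  assumes e: "e \<in> carrier C" and R': "cring R'" and h: "h \<in> ring_hom R (R' :: 'r ring)"
  shows "(\<lambda>g \<in> carrier G. h (e g)) \<in> carrier (const_sections G R')"
proof -
  interpret R': plain_cring R' using R' by (rule plain_cring.intro)
  interpret h: ring_hom_cring R R' h
    by (intro ring_hom_cring.intro ring_hom_cring_axioms.intro) (use h R.cring_axioms R' in auto)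
  note D = R.const_memD[OF e]
  let ?f = "\<lambda>g \<in> carrier G. h (e g)"
  have sub: "supp G R' ?f \<subseteq> supp G R e" by (auto simp: supp_def)
  show ?thesis
  proof (rule R'.const_memI)
    show "finite (supp G R' ?f)" using sub D(2) by (rule finite_subset)
    have "finsum R' ?f (supp G R' ?f) = finsum R' (h \<circ> e) (supp G R e)"
      by (rule R'.add.finprod_mono_neutral_cong_left)
        (use sub D in \<open>auto simp: supp_def\<close>)
    also have "\<dots> = h (finsum R e (supp G R e))" using h.hom_finsum[OF D(6)] by (simp add: comp_def)
    finally show "finsum R' ?f (supp G R' ?f) = \<one>\<^bsub>R'\<^esub>" using D by simp
    show "?f a \<otimes>\<^bsub>R'\<^esub> ?f b = \<zero>\<^bsub>R'\<^esub>" if "a \<in> carrier G" "b \<in> carrier G" "a \<noteq> b" for a b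
      using D(1)[of a] D(1)[of b] D(3)[of a b] that h.hom_mult[of "e a" "e b"] by simp
  qed (use D in auto)
qed

lemma restr_hom:
  assumes R': "cring R'" and h: "h \<in> ring_hom R (R' :: 'r ring)"
  shows "(\<lambda>e. \<lambda>g \<in> carrier G. h (e g)) \<in> hom C (const_sections G R')"
proof (rule homI)
  interpret R': const_setup G R'
    using R' G.comm_group_axioms by (auto simp: const_setup_def plain_cring_def)
  interpret h: ring_hom_cring R R' h
    by (intro ring_hom_cring.intro ring_hom_cring_axioms.intro) (use h R.cring_axioms R' in auto)
  fix e f assume e: "e \<in> carrier C" and f: "f \<in> carrier C"
  note De = R.const_memD(1)[OF e] and Df = R.const_memD(1)[OF f]
  show "(\<lambda>g \<in> carrier G. h (e g)) \<in> carrier (const_sections G R')"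
    using e R' h by (rule restr_mem)
  show "(\<lambda>g \<in> carrier G. h ((e \<otimes>\<^bsub>C\<^esub> f) g)) = (\<lambda>g \<in> carrier G. h (e g)) \<otimes>\<^bsub>R'.C\<^esub> (\<lambda>g \<in> carrier G. h (f g))"
  proof (rule R'.conv_eqI'[symmetric])
    fix a b c assume abc: "a \<in> carrier G" "b \<in> carrier G" "c \<in> carrier G"
    have "h (e a \<otimes>\<^bsub>R\<^esub> f b \<otimes>\<^bsub>R\<^esub> (e \<otimes>\<^bsub>C\<^esub> f) c) = h (e a) \<otimes>\<^bsub>R'\<^esub> h (f b) \<otimes>\<^bsub>R'\<^esub> h ((e \<otimes>\<^bsub>C\<^esub> f) c)"
      using De Df abc conv_closed_R[OF e f] by simp
    then show "(\<lambda>g \<in> carrier G. h (e g)) a \<otimes>\<^bsub>R'\<^esub> (\<lambda>g \<in> carrier G. h (f g)) b \<otimes>\<^bsub>R'\<^esub>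
        (\<lambda>g \<in> carrier G. h ((e \<otimes>\<^bsub>C\<^esub> f) g)) c =
        (if c = a \<otimes>\<^bsub>G\<^esub> b then (\<lambda>g \<in> carrier G. h (e g)) a \<otimes>\<^bsub>R'\<^esub> (\<lambda>g \<in> carrier G. h (f g)) b
         else \<zero>\<^bsub>R'\<^esub>)"
      using conv_local[OF e f abc] De Df abc by (simp split: if_splits)
  qed (use restr_mem[OF _ R' h] e f conv_closed in auto)
qed

lemma glue_natural:
  assumes e: "e \<in> carrier C" and R': "cring R'" and h: "h \<in> ring_hom R (R' :: 'r ring)"
    and k: "k \<in> carrier G \<rightarrow> carrier R" and k': "\<And>g. g \<in> carrier G \<Longrightarrow> k' g = h (k g)"
  shows "const_setup.glue G R' k' (\<lambda>g \<in> carrier G. h (e g)) = h (glue k e)"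
proof -
  interpret R': const_setup G R'
    using R' G.comm_group_axioms by (auto simp: const_setup_def plain_cring_def)
  interpret h: ring_hom_cring R R' h
    by (intro ring_hom_cring.intro ring_hom_cring_axioms.intro) (use h R.cring_axioms R' in auto)
  note D = R.const_memD(1)[OF e] and e' = restr_mem[OF e R' h]
  have k1: "k' \<in> carrier G \<rightarrow> carrier R'"
    using k k' h.hom_closed by (auto simp: Pi_iff)
  show ?thesis
  proof (rule R'.R.const_eqI[OF e'])
    fix a assume a: "a \<in> carrier G"
    then have ka: "k a \<in> carrier R" using k by auto
    have "h (e a) \<otimes>\<^bsub>R'\<^esub> h (glue k e) = h (e a \<otimes>\<^bsub>R\<^esub> glue k e)"
      using D a glue_closed[OF e k] by simp
    also have "\<dots> = h (e a) \<otimes>\<^bsub>R'\<^esub> h (k a)" using glue_local[OF e k a] D a ka by simp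
    finally show "(\<lambda>g \<in> carrier G. h (e g)) a \<otimes>\<^bsub>R'\<^esub> R'.glue k' (\<lambda>g \<in> carrier G. h (e g))
        = (\<lambda>g \<in> carrier G. h (e g)) a \<otimes>\<^bsub>R'\<^esub> h (glue k e)"
      using R'.glue_local[OF e' k1 a] a k' by simp
  qed (use R'.glue_closed[OF e' k1] glue_closed[OF e k] in auto)
qed

end

lemma const_is_group_functor:
  assumes "comm_group G"
  shows "is_group_functor B (const_functor G :: ('b, 'r, 'g \<Rightarrow> 'r) group_functor)"
proof -
  have S: "const_setup G (fst S)" if "S \<in> algebras B" for S :: "('b, 'r) algebra"
    using that assms by (auto simp: algebras_def const_setup_def plain_cring_def)
  have cr: "cring (fst S)" if "S \<in> algebras B" for S :: "('b, 'r) algebra"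
    using that by (auto simp: algebras_def)
  have ext: "(\<lambda>g \<in> carrier G. h (e g)) = e"
    if "S \<in> algebras B" "e \<in> carrier (const_sections G (fst S))" "\<And>x. x \<in> carrier (fst S) \<Longrightarrow> h x = x"
    for S :: "('b, 'r) algebra" and h e
    using that plain_cring.const_memD(1,5)[OF _ that(2)] cr[OF that(1)]
    by (intro ext) (auto simp: plain_cring_def extensional_def restrict_def)
  have mem: "e g \<in> carrier (fst S)"
    if "S \<in> algebras B" "e \<in> carrier (const_sections G (fst S))" "g \<in> carrier G"
    for S :: "('b, 'r) algebra" and e g
    using plain_cring.const_memD(1)[OF _ that(2,3)] cr[OF that(1)] by (simp add: plain_cring_def)
  show ?thesis
    unfolding is_group_functor_def const_functor_def group_functor.simps
    using const_setup.const_comm_group[OF S] const_setup.restr_hom[OF S cr] ext mem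
    by (auto simp: algebra_hom_def restrict_def)
qed

lemma Gm2_comm_group:
  assumes "cring R"
  shows "comm_group (Gm2 R)"
proof -
  interpret R: cring R by fact
  interpret U: comm_group "units_of R" by (rule R.units_comm_group)
  show ?thesis unfolding Gm2_def
    by (rule group.group_comm_groupI[OF DirProd_group]) (auto simp: U.is_group U.m_comm)
qed

lemma ring_hom_Gm2:
  assumes "cring R" "cring R'" "h \<in> ring_hom R R'"
  shows "(\<lambda>s. (h (fst s), h (snd s))) \<in> hom (Gm2 R) (Gm2 R')"
proof -
  interpret R: cring R by fact
  interpret R': cring R' by fact
  interpret h: ring_hom_cring R R' h
    by (intro ring_hom_cring.intro ring_hom_cring_axioms.intro) (use assms in auto)
  have U: "h x \<in> Units R'" if "x \<in> Units R" for x
  proof -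
    have "h x \<otimes>\<^bsub>R'\<^esub> h (inv\<^bsub>R\<^esub> x) = \<one>\<^bsub>R'\<^esub>"
      using that h.hom_mult[of x "inv\<^bsub>R\<^esub> x"] by (simp add: R.Units_closed)
    then show ?thesis
      using that R'.m_comm[of "h x" "h (inv\<^bsub>R\<^esub> x)"] by (auto simp: Units_def[of R'] R.Units_closed)
  qed
  show ?thesis
    by (auto simp: hom_def Gm2_def units_of_def DirProd_def U R.Units_closed)
qed

lemma torus_is_group_functor:
  "is_group_functor B (torus_functor :: ('b, 'r, 'r \<times> 'r) group_functor)"
proof -
  have U: "x \<in> carrier R" if "x \<in> Units R" for x and R :: "'r ring"
    using that by (simp add: Units_def)
  show ?thesis
    unfolding is_group_functor_def torus_functor_def group_functor.simps
    by (auto simp: algebra_hom_def algebras_def Gm2_comm_group ring_hom_Gm2)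
      (auto simp: Gm2_def units_of_def U)
qed

lemma zero_is_group_functor: "is_group_functor B zero_functor"
  by (simp add: is_group_functor_def zero_functor_def hom_def)

lemma subgroup_comm_group:
  assumes "comm_group T" "subgroup H T"
  shows "comm_group (T\<lparr>carrier := H\<rparr>)"
proof -
  interpret T: comm_group T by fact
  show ?thesis
    by (rule group.group_comm_groupI[OF T.subgroup_imp_group[OF assms(2)]])
      (use subgroup.subset[OF assms(2)] T.m_comm in auto)
qed

lemma incl_map_hom:
  assumes B: "cring B" and sub: "subgroup \<Gamma> (Gm2 B)"
  shows "is_functor_hom B (const_functor ((Gm2 B)\<lparr>carrier := \<Gamma>\<rparr>))
    (torus_functor :: ('b, 'r, 'r \<times> 'r) group_functor) (incl_map ((Gm2 B)\<lparr>carrier := \<Gamma>\<rparr>))"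
proof -
  let ?G = "(Gm2 B)\<lparr>carrier := \<Gamma>\<rparr>"
  interpret B: cring B by fact
  interpret T: comm_group "Gm2 B" using B by (rule Gm2_comm_group)
  have G: "comm_group ?G" using subgroup_comm_group[OF T.comm_group_axioms sub] .
  have mem: "fst g \<in> carrier B" "snd g \<in> carrier B" if "g \<in> \<Gamma>" for g
  proof -
    have "g \<in> carrier (Gm2 B)" using subgroup.subset[OF sub] that by blast
    then show "fst g \<in> carrier B" "snd g \<in> carrier B"
      by (auto simp: Gm2_def units_of_def B.Units_closed)
  qed
  have cs: "const_setup ?G (fst S)" if "S \<in> algebras B" for S :: "('b, 'r) algebra"
    using that G by (auto simp: algebras_def const_setup_def plain_cring_def)
  have glue: "incl_map ?G S e =
      (const_setup.glue ?G (fst S) (snd S \<circ> fst) e, const_setup.glue ?G (fst S) (snd S \<circ> snd) e)"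
    if "S \<in> algebras B" for S :: "('b, 'r) algebra" and e
    unfolding incl_map_def const_setup.glue_def[OF cs[OF that]] comp_def ..
  have st: "snd S \<circ> f \<in> carrier ?G \<rightarrow> carrier (fst S)"
    "(snd S \<circ> f) \<one>\<^bsub>?G\<^esub> = \<one>\<^bsub>fst S\<^esub>"
    "\<And>a b. a \<in> carrier ?G \<Longrightarrow> b \<in> carrier ?G \<Longrightarrow>
       (snd S \<circ> f) (a \<otimes>\<^bsub>?G\<^esub> b) = (snd S \<circ> f) a \<otimes>\<^bsub>fst S\<^esub> (snd S \<circ> f) b"
    if "S \<in> algebras B" "f = fst \<or> f = snd" for S :: "('b, 'r) algebra" and f
  proof -
    have h: "snd S \<in> ring_hom B (fst S)" using that(1) by (auto simp: algebras_def)
    have m: "f g \<in> carrier B" if "g \<in> \<Gamma>" for g using that mem \<open>f = fst \<or> f = snd\<close> by blast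
    have fm: "f (a \<otimes>\<^bsub>?G\<^esub> b) = f a \<otimes>\<^bsub>B\<^esub> f b" for a b
      using that(2) by (elim disjE) (simp_all add: Gm2_def units_of_def DirProd_def split_beta)
    have f1: "f \<one>\<^bsub>?G\<^esub> = \<one>\<^bsub>B\<^esub>"
      using that(2) by (elim disjE) (simp_all add: Gm2_def units_of_def)
    show "snd S \<circ> f \<in> carrier ?G \<rightarrow> carrier (fst S)"
      using ring_hom_closed[OF h] m by auto
    show "(snd S \<circ> f) \<one>\<^bsub>?G\<^esub> = \<one>\<^bsub>fst S\<^esub>"
      unfolding comp_def f1 by (rule ring_hom_one[OF h])
    show "(snd S \<circ> f) (a \<otimes>\<^bsub>?G\<^esub> b) = (snd S \<circ> f) a \<otimes>\<^bsub>fst S\<^esub> (snd S \<circ> f) b"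
      if "a \<in> carrier ?G" "b \<in> carrier ?G" for a b
      unfolding comp_def fm using that m by (intro ring_hom_mult[OF h]) auto
  qed
  show ?thesis
    unfolding is_functor_hom_def
  proof (intro conjI ballI)
    fix S :: "('b, 'r) algebra" assume S: "S \<in> algebras B"
    have "const_setup.glue ?G (fst S) (snd S \<circ> f) \<in> hom (const_sections ?G (fst S)) (units_of (fst S))"
      if "f = fst \<or> f = snd" for f
      using const_setup.glue_hom[OF cs[OF S] st[OF S that]] .
    then have "(\<lambda>e. incl_map ?G S e) \<in> hom (const_sections ?G (fst S)) (units_of (fst S) \<times>\<times> units_of (fst S))"
      by (subst hom_pairwise) (simp only: comp_def glue[OF S] fst_conv snd_conv simp_thms)
    then show "incl_map ?G S \<in> hom (sections (const_functor ?G) S) (sections torus_functor S)"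
      by (simp add: const_functor_def torus_functor_def Gm2_def[of "fst S"])
  next
    fix S S' :: "('b, 'r) algebra" and h e
    assume S: "S \<in> algebras B" and S': "S' \<in> algebras B" and h: "h \<in> algebra_hom B S S'"
      and e: "e \<in> carrier (sections (const_functor ?G) S)"
    have cr: "cring (fst S')" using S' by (auto simp: algebras_def)
    have hh: "h \<in> ring_hom (fst S) (fst S')" using h by (simp add: algebra_hom_def)
    have ee: "e \<in> carrier (const_sections ?G (fst S))" using e by (simp add: const_functor_def)
    have "const_setup.glue ?G (fst S') (snd S' \<circ> f) (\<lambda>g \<in> carrier ?G. h (e g))
        = h (const_setup.glue ?G (fst S) (snd S \<circ> f) e)" if f: "f = fst \<or> f = snd" for f
      by (rule const_setup.glue_natural[OF cs[OF S] ee cr hh st(1)[OF S f]])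
        (use h f mem in \<open>auto simp: algebra_hom_def\<close>)
    then show "incl_map ?G S' (restriction (const_functor ?G) S S' h e)
        = restriction torus_functor S S' h (incl_map ?G S e)"
      by (simp add: glue[OF S] glue[OF S'] const_functor_def torus_functor_def)
  qed
qed

lemma subgroup_motive_diagram:
  fixes B :: "'b ring" and \<Gamma> :: "('b \<times> 'b) set"
  assumes "cring B" "subgroup \<Gamma> (Gm2 B)"
  shows "motive_diagram B (subgroup_motive B \<Gamma> :: ('b, 'r, 'b \<times> 'b) toric_motive)"
proof -
  interpret T: comm_group "Gm2 B" using assms(1) by (rule Gm2_comm_group)
  have 1: "is_functor_hom B torus_functor torus_functor (\<lambda>S z. z)"
    by (simp add: is_functor_hom_def hom_def)
  have 2: "is_functor_hom B torus_functor zero_functor (\<lambda>S z. ())"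
    by (simp add: is_functor_hom_def hom_def zero_functor_def singleton_group_def)
  have 3: "carrier (sections torus_functor S) \<noteq> {}" if "S \<in> algebras B" for S :: "('b, 'r) algebra"
  proof -
    interpret comm_group "Gm2 (fst S)"
      by (rule Gm2_comm_group) (use that in \<open>auto simp: algebras_def\<close>)
    show ?thesis using one_closed unfolding torus_functor_def group_functor.simps by blast
  qed
  have ex: "\<forall>S \<in> (algebras B :: ('b, 'r) algebra set).
      inj_on (\<lambda>z. z) (carrier (sections torus_functor S)) \<and>
      (\<lambda>z. z) ` carrier (sections torus_functor S) =
        kernel (sections torus_functor S) (sections zero_functor S) (\<lambda>z. ()) \<and>
      (\<lambda>z. ()) ` carrier (sections torus_functor S) = carrier (sections zero_functor S)"
  proof (intro ballI conjI)
    fix S :: "('b, 'r) algebra" assume "S \<in> algebras B"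
    from 3[OF this] obtain z where "z \<in> carrier (sections torus_functor S)" by blast
    then show "(\<lambda>z. ()) ` carrier (sections torus_functor S) = carrier (sections zero_functor S)"
      unfolding zero_functor_def group_functor.simps carrier_singleton_group by blast
  qed (simp_all add: kernel_def zero_functor_def singleton_group_def)
  show ?thesis
    unfolding motive_diagram_def subgroup_motive_def motive.simps
    by (rule conjI const_is_group_functor subgroup_comm_group T.comm_group_axioms assms
        torus_is_group_functor zero_is_group_functor 1 2 incl_map_hom ex)+
qed

end

theory Submission
  imports Defs
begin

text \<open>
  All four groups contain \<open>M = M\<^sub>1 \<cdots> M\<^sub>t\<close>, so it suffices that \<open>r\<^sub>p\<close> maps \<open>\<lambda>\<^sub>j\<close> and \<open>\<lambda>\<^sub>j'\<close>
  into \<open>r\<^sub>p(M\<^sub>j)\<close>; then every one of them has image \<open>r\<^sub>p(M)\<close>.  The reductions of the primes in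
  \<open>S\<^sub>j\<close> are powers \<open>\<gamma> ^ b\<^sub>i\<close> of one element, and after extracting the common divisor the \<open>b\<^sub>i\<close> are
  coprime.  A Dedekind--Mertens argument on the exponents shows that the staircase generators
  of \<open>M\<^sub>j\<close> then generate all of \<open>\<langle>\<gamma>\<rangle> \<times> \<langle>\<gamma>\<rangle>\<close>.

  The groups consist of pairs of positive \<open>\<Sigma>\<close>-units, on which the valuations at \<open>\<Sigma>\<close> are jointly
  injective, so they are lattices.
\<close>

section \<open>Lattices and homomorphisms to the integers\<close>

text \<open>The least positive element divides every other one by division with remainder. Applied
  to the image of a homomorphism into the integers and to sets of exponents.\<close>

lemma int_ideal_principal:
  fixes D :: "int set"
  assumes zero: "0 \<in> D"
    and diff: "\<And>a b. a \<in> D \<Longrightarrow> b \<in> D \<Longrightarrow> a - b \<in> D"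
    and mult: "\<And>a k. a \<in> D \<Longrightarrow> k * a \<in> D"
  obtains d where "d \<in> D" "\<And>x. x \<in> D \<Longrightarrow> d dvd x"
proof (cases "\<exists>x \<in> D. x \<noteq> 0")
  case False
  then show ?thesis using zero that by auto
next
  case True
  then obtain y where y: "y \<in> D" "y \<noteq> 0" by blast
  then have "\<bar>y\<bar> \<in> D" using mult[of y "sgn y"] by (simp add: abs_sgn mult.commute)
  then have ex: "\<exists>m::nat. m > 0 \<and> int m \<in> D"
    using y by (intro exI[of _ "nat \<bar>y\<bar>"]) simp
  define d where "d = (LEAST m::nat. m > 0 \<and> int m \<in> D)"
  have d: "d > 0" "int d \<in> D" using LeastI_ex[OF ex] by (auto simp: d_def)
  have "int d dvd x" if "x \<in> D" for x
  proof (rule ccontr)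
    assume "\<not> int d dvd x"
    then have "x mod int d > 0" using d(1) by (metis dvd_imp_mod_0 mod_0_imp_dvd of_nat_0_less_iff order_less_le pos_mod_sign)
    moreover have "x mod int d \<in> D"
      using diff[OF that mult[OF d(2), of "x div int d"]] by (simp add: minus_div_mult_eq_mod)
    ultimately have "d \<le> nat (x mod int d)"
      unfolding d_def by (intro Least_le) simp
    then show False using d(1) pos_mod_bound[of "int d" x] by linarith
  qed
  then show ?thesis using that d by blast
qed

text \<open>The image of \<open>\<phi>\<close> is zero or infinite cyclic, hence free, so
  \<open>G\<close> splits over the kernel: a preimage of a generator of the image extends a basis of
  the kernel to a basis of \<open>G\<close>.\<close>

lemma is_lattice_extend:
  assumes G: "comm_group G" and \<phi>: "\<phi> \<in> hom G integer_group"
    and K: "is_lattice (G\<lparr>carrier := kernel G integer_group \<phi>\<rparr>)"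
  shows "is_lattice G"
proof -
  interpret G: comm_group G by fact
  interpret \<phi>: group_hom G integer_group \<phi>
    by (intro group_hom.intro group_hom_axioms.intro) (simp_all add: G.is_group \<phi>)
  let ?K = "G\<lparr>carrier := kernel G integer_group \<phi>\<rparr>"
  have subK: "subgroup (kernel G integer_group \<phi>) G" by (rule \<phi>.subgroup_kernel)
  interpret K: group ?K using G.subgroup_imp_group[OF subK] .
  obtain n f where f: "f \<in> iso (free_Abelian_group {..<n::nat}) ?K"
    using K K.iso_sym unfolding is_lattice_def is_iso_def ex_in_conv[symmetric] by metis
  have \<phi>_mult: "\<phi> (x \<otimes>\<^bsub>G\<^esub> y) = \<phi> x + \<phi> y" if "x \<in> carrier G" "y \<in> carrier G" for x y
    using \<phi>.hom_mult[OF that] by simp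
  have \<phi>_pow: "\<phi> (x [^]\<^bsub>G\<^esub> k) = k * \<phi> x" if "x \<in> carrier G" for x and k :: int
    using \<phi>.hom_int_pow[OF that] that by simp
  have \<phi>_inv: "\<phi> (inv\<^bsub>G\<^esub> x) = - \<phi> x" if "x \<in> carrier G" for x
    using \<phi>.hom_inv[OF that] by simp
  show ?thesis
  proof (cases "\<forall>x \<in> carrier G. \<phi> x = 0")
    case True
    then have "?K = G" by (simp add: kernel_def Collect_conj_eq inf_absorb1 subset_iff)
    then show ?thesis using K by simp
  next
    case False
    obtain d where d: "d \<in> \<phi> ` carrier G" "\<And>y. y \<in> \<phi> ` carrier G \<Longrightarrow> d dvd y"
    proof (rule int_ideal_principal[of "\<phi> ` carrier G"])
      show "0 \<in> \<phi> ` carrier G" using \<phi>.hom_one G.one_closed by (metis image_eqI one_integer_group)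
      show "a - b \<in> \<phi> ` carrier G" if ab: "a \<in> \<phi> ` carrier G" "b \<in> \<phi> ` carrier G" for a b
      proof -
        obtain x y where "x \<in> carrier G" "y \<in> carrier G" "a = \<phi> x" "b = \<phi> y"
          using ab by blast
        then show ?thesis
          using \<phi>_mult[of x "inv\<^bsub>G\<^esub> y"] \<phi>_inv[of y] by (intro image_eqI[of _ _ "x \<otimes>\<^bsub>G\<^esub> inv\<^bsub>G\<^esub> y"]) simp_all
      qed
      show "k * a \<in> \<phi> ` carrier G" if a: "a \<in> \<phi> ` carrier G" for a k
      proof -
        obtain x where "x \<in> carrier G" "a = \<phi> x" using a by blast
        then show ?thesis
          using \<phi>_pow[of x k] by (intro image_eqI[of _ _ "x [^]\<^bsub>G\<^esub> k"]) simp_all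
      qed
    qed blast
    obtain g where g: "g \<in> carrier G" and "d = \<phi> g" using d(1) by (rule imageE)
    then have dvd: "\<phi> g dvd \<phi> x" if "x \<in> carrier G" for x using d(2) that by simp
    from False dvd have g0: "\<phi> g \<noteq> 0" by auto
    let ?F = "free_Abelian_group {..<Suc n}"
    \<comment> \<open>The new basis vector \<open>n\<close> is sent to \<open>g\<close>:
      \<open>?k c\<close> is its coefficient in \<open>c\<close>, and \<open>?r c\<close> is the
      part of \<open>c\<close> supported on the old basis.\<close>
    let ?k = "\<lambda>c. Poly_Mapping.lookup c n"
    let ?r = "\<lambda>c. c - frag_cmul (?k c) (frag_of n)"
    define h where "h c = f (?r c) \<otimes>\<^bsub>G\<^esub> g [^]\<^bsub>G\<^esub> ?k c" for c
    have r: "?r c \<in> carrier (free_Abelian_group {..<n})" if "c \<in> carrier ?F" for c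
      using that by (auto simp: in_keys_iff lookup_minus less_Suc_eq subset_iff split: if_splits)
    have fK: "f c \<in> carrier G" "\<phi> (f c) = 0" if "c \<in> carrier (free_Abelian_group {..<n})" for c
      using f that by (auto simp: iso_def hom_def kernel_def Pi_iff)
    have h_hom: "h \<in> hom ?F G"
    proof (rule homI)
      fix c d assume c: "c \<in> carrier ?F" and d: "d \<in> carrier ?F"
      show "h c \<in> carrier G" using fK r c g by (simp add: h_def)
      have "?r (c + d) = ?r c + ?r d"
        by (simp add: lookup_add frag_cmul_distrib algebra_simps)
      then have "f (?r (c + d)) = f (?r c + ?r d)" by (simp only:)
      also have "\<dots> = f (?r c) \<otimes>\<^bsub>G\<^esub> f (?r d)"
        using f r[OF c] r[OF d] hom_mult[of f "free_Abelian_group {..<n}" ?K] by (simp add: iso_def)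
      finally show "h (c \<otimes>\<^bsub>?F\<^esub> d) = h c \<otimes>\<^bsub>G\<^esub> h d"
        using fK[OF r[OF c]] fK[OF r[OF d]] g
        by (simp add: h_def lookup_add G.int_pow_mult G.m_ac)
    qed
    then interpret h: group_hom ?F G h
      by (intro group_hom.intro group_hom_axioms.intro) (simp_all add: G.is_group)
    have \<phi>h: "\<phi> (h c) = ?k c * \<phi> g" if "c \<in> carrier ?F" for c
      using fK[OF r[OF that]] g by (simp add: h_def \<phi>_mult \<phi>_pow)
    have "h \<in> iso ?F G"
      unfolding h.iso_iff
    proof (intro conjI ballI impI subsetI)
      fix x assume x: "x \<in> carrier G"
      \<comment> \<open>Dividing \<open>\<phi> x\<close> by \<open>\<phi> g\<close> tells which
        power of \<open>g\<close> to remove so that the rest of \<open>x\<close> lies in the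
        kernel.\<close>
      obtain k where k: "\<phi> x = \<phi> g * k" using dvd[OF x] by (elim dvdE)
      have "x \<otimes>\<^bsub>G\<^esub> g [^]\<^bsub>G\<^esub> (- k) \<in> carrier ?K"
        using x g k by (simp add: kernel_def \<phi>_mult \<phi>_pow del: G.int_pow_neg)
      then obtain c where c: "c \<in> carrier (free_Abelian_group {..<n})"
        and fc: "f c = x \<otimes>\<^bsub>G\<^esub> g [^]\<^bsub>G\<^esub> (- k)"
        using f unfolding iso_def bij_betw_def by (elim CollectE conjE) (metis imageE)
      have "?k c = 0" using c by (auto simp: in_keys_iff)
      then have "h (c + frag_cmul k (frag_of n)) = x \<otimes>\<^bsub>G\<^esub> g [^]\<^bsub>G\<^esub> (- k) \<otimes>\<^bsub>G\<^esub> g [^]\<^bsub>G\<^esub> k"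
        by (simp add: h_def lookup_add fc)
      also have "\<dots> = x" using x g by (simp add: G.m_assoc G.int_pow_neg)
      finally have "x = h (c + frag_cmul k (frag_of n))" ..
      moreover have "c + frag_cmul k (frag_of n) \<in> carrier ?F"
        using c keys_add[of c "frag_cmul k (frag_of n)"] by (fastforce split: if_splits)
      ultimately show "x \<in> h ` carrier ?F" by (rule image_eqI)
    next
      \<comment> \<open>Since \<open>\<phi> (h c)\<close> is \<open>?k c\<close> times the nonzero
        \<open>\<phi> g\<close>, triviality of \<open>h c\<close> kills the coefficient of the new
        basis vector; injectivity of \<open>f\<close> does the rest.\<close>
      fix c assume c: "c \<in> carrier ?F" and h1: "h c = \<one>\<^bsub>G\<^esub>"
      then have "?k c = 0" using \<phi>h[OF c] \<phi>.hom_one g0 by simp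
      then have "f c = \<one>\<^bsub>?K\<^esub>" and c': "c \<in> carrier (free_Abelian_group {..<n})"
        using h1 fK r[OF c] by (simp_all add: h_def)
      interpret f: group_hom "free_Abelian_group {..<n}" ?K f
        by (intro group_hom.intro group_hom_axioms.intro)
          (use f K.is_group in \<open>simp_all add: iso_def\<close>)
      show "c = \<one>\<^bsub>?F\<^esub>" using f \<open>f c = \<one>\<^bsub>?K\<^esub>\<close> c' unfolding f.iso_iff by simp
    qed
    then show ?thesis
      unfolding is_lattice_def using G group.iso_sym[OF group_free_Abelian_group is_isoI] by blast
  qed
qed

lemma is_lattice_trivial:
  assumes "comm_group G" "carrier G = {\<one>\<^bsub>G\<^esub>}"
  shows "is_lattice G"
proof -
  interpret G: comm_group G by fact
  have "(\<lambda>_. 0) \<in> iso G (free_Abelian_group {..<0::nat})"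
    using assms(2) by (auto simp: iso_def hom_def bij_betw_def)
  then show ?thesis unfolding is_lattice_def using assms(1) by (blast intro: is_isoI)
qed

text \<open>The maps embed \<open>G\<close> in a finite power of the integers. The induction passes
  to the kernel of one \<open>\<phi> i\<close>, on which the remaining maps are still jointly
  injective; hence \<open>G\<close> varies.\<close>

lemma is_lattice_of_homs:
  assumes "finite I" "comm_group G"
    and "\<And>i. i \<in> I \<Longrightarrow> \<phi> i \<in> hom G integer_group"
    and "\<And>x. x \<in> carrier G \<Longrightarrow> (\<And>i. i \<in> I \<Longrightarrow> \<phi> i x = 0) \<Longrightarrow> x = \<one>\<^bsub>G\<^esub>"
  shows "is_lattice G"
  using assms
proof (induction I arbitrary: G)
  case empty
  interpret comm_group G by fact
  show ?case using empty by (intro is_lattice_trivial) auto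
next
  case (insert i I)
  interpret G: comm_group G by fact
  interpret \<phi>: group_hom G integer_group "\<phi> i"
    by (intro group_hom.intro group_hom_axioms.intro) (simp_all add: G.is_group insert.prems(2))
  have "is_lattice (G\<lparr>carrier := kernel G integer_group (\<phi> i)\<rparr>)"
  proof (rule insert.IH)
    show "comm_group (G\<lparr>carrier := kernel G integer_group (\<phi> i)\<rparr>)"
      by (rule subgroup_comm_group[OF G.comm_group_axioms \<phi>.subgroup_kernel])
    show "\<phi> j \<in> hom (G\<lparr>carrier := kernel G integer_group (\<phi> i)\<rparr>) integer_group" if "j \<in> I" for j
      using insert.prems(2)[of j] that by (auto simp: hom_def kernel_def)
    fix x assume "x \<in> carrier (G\<lparr>carrier := kernel G integer_group (\<phi> i)\<rparr>)" "\<And>j. j \<in> I \<Longrightarrow> \<phi> j x = 0"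
    then show "x = \<one>\<^bsub>G\<lparr>carrier := kernel G integer_group (\<phi> i)\<rparr>\<^esub>"
      using insert.prems(3)[of x] by (auto simp: kernel_def)
  qed
  then show ?case using is_lattice_extend insert.prems by blast
qed

text \<open>The finite subgroup may be all of \<open>G\<close>; the quotient is then the lattice of
  rank zero.\<close>

lemma finite_lattice_by_finite:
  assumes "comm_group G" "finite (carrier G)"
  shows "lattice_by_finite G"
proof -
  interpret G: comm_group G by fact
  interpret Q: comm_group "G Mod carrier G" by (rule G.abelian_FactGroup[OF G.subgroup_self])
  have "carrier (G Mod carrier G) = {carrier G}"
    using G.coset_join2[OF _ G.subgroup_self] G.one_closed
    by (auto simp: FactGroup_def RCOSETS_def)
  then have "is_lattice (G Mod carrier G)"
    by (intro is_lattice_trivial Q.comm_group_axioms) (simp add: FactGroup_def)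
  then show ?thesis unfolding lattice_by_finite_def using assms G.subgroup_self by blast
qed

section \<open>Products of subgroups and cyclic subgroups\<close>

lemma subset_set_mult:
  assumes "group G" "subgroup H G" "subgroup K G"
  shows "H \<subseteq> H <#>\<^bsub>G\<^esub> K" "K \<subseteq> H <#>\<^bsub>G\<^esub> K"
proof -
  interpret group G by fact
  interpret H: subgroup H G by fact
  interpret K: subgroup K G by fact
  have "x = x \<otimes>\<^bsub>G\<^esub> \<one>\<^bsub>G\<^esub>" if "x \<in> H" for x using that by simp
  then show "H \<subseteq> H <#>\<^bsub>G\<^esub> K" using K.one_closed unfolding set_mult_def by blast
  have "x = \<one>\<^bsub>G\<^esub> \<otimes>\<^bsub>G\<^esub> x" if "x \<in> K" for x using that by simp
  then show "K \<subseteq> H <#>\<^bsub>G\<^esub> K" using H.one_closed unfolding set_mult_def by blast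
qed

lemma set_mult_subset_subgroup:
  assumes "subgroup L G" "H \<subseteq> L" "K \<subseteq> L"
  shows "H <#>\<^bsub>G\<^esub> K \<subseteq> L"
  using assms subgroup.m_closed[OF assms(1)] by (auto simp: set_mult_def)

lemma subgroup_prod_subgroup:
  assumes "comm_group G" "\<And>i. i \<in> set xs \<Longrightarrow> subgroup (f i) G"
  shows "subgroup (subgroup_prod G (map f xs)) G"
proof -
  interpret comm_group G by fact
  show ?thesis using assms(2)
    by (induction xs) (auto simp: subgroup_prod_def triv_subgroup intro: mult_subgroups)
qed

text \<open>Together with \<open>subset_subgroup_prod\<close> it identifies the product, in a
  commutative group, as the smallest subgroup containing all factors.\<close>

lemma subgroup_prod_subset:
  assumes "subgroup L G" "\<And>i. i \<in> set xs \<Longrightarrow> f i \<subseteq> L"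
  shows "subgroup_prod G (map f xs) \<subseteq> L"
  using assms(2) subgroup.one_closed[OF assms(1)]
  by (induction xs) (simp_all add: subgroup_prod_def set_mult_subset_subgroup[OF assms(1)])

lemma subset_subgroup_prod:
  assumes G: "comm_group G" and "\<And>i. i \<in> set xs \<Longrightarrow> subgroup (f i) G" "i \<in> set xs"
  shows "f i \<subseteq> subgroup_prod G (map f xs)"
  using assms(2,3)
proof (induction xs)
  case (Cons k xs)
  interpret comm_group G by fact
  let ?P = "subgroup_prod G (map f xs)"
  have "subgroup ?P G" using Cons.prems by (intro subgroup_prod_subgroup[OF G]) auto
  then have "f k \<subseteq> subgroup_prod G (map f (k # xs))" "?P \<subseteq> subgroup_prod G (map f (k # xs))"
    using subset_set_mult[OF is_group, of "f k" ?P] Cons.prems by (simp_all add: subgroup_prod_def)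
  then show ?case using Cons.IH Cons.prems by auto
qed auto

lemma zpowers_subgroup:
  assumes "group G" "a \<in> carrier G"
  shows "subgroup (zpowers G a) G"
proof -
  interpret group G by fact
  have "zpowers G a = generate G {a}"
    using generate_pow[OF assms(2)] by (auto simp: zpowers_def)
  then show ?thesis using generate_is_subgroup[of "{a}"] assms(2) by simp
qed

lemma mem_zpowers: "group G \<Longrightarrow> a \<in> carrier G \<Longrightarrow> a \<in> zpowers G a"
  unfolding zpowers_def by (auto intro!: exI[of _ 1] simp: group.int_pow_1)

lemma zpowers_subset:
  assumes "group G" "subgroup L G" "a \<in> L"
  shows "zpowers G a \<subseteq> L"
  using group.subgroup_int_pow_closed[OF assms] by (auto simp: zpowers_def)

section \<open>The staircase argument on exponents\<close>

text \<open>
  Modulo \<open>W\<close> the assumption \<open>step\<close> gives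
  \<open>(\<gamma>, 1) ^ (b i * b (j + 1)) \<sim> (1, \<gamma>) ^ (- b i * b j) \<sim> (\<gamma>, 1) ^ (b (i + 1) * b j)\<close>,
  so the index \<open>j\<close> descends to \<open>0\<close>, where the exponent vanishes; coprimality of the products
  \<open>b i * b j\<close> does the rest.
\<close>

lemma staircase_subgroup:
  fixes n :: nat and b :: "nat \<Rightarrow> int" and k :: int
  assumes U: "group U" and W: "subgroup W (U \<times>\<times> U)" and \<gamma>: "\<gamma> \<in> carrier U"
    and b: "b 0 = 0" "\<And>i. i > n \<Longrightarrow> b i = 0" "Gcd (range b) = 1"
    and step: "\<And>i. i \<le> n \<Longrightarrow> (\<gamma> [^]\<^bsub>U\<^esub> b (Suc i), \<gamma> [^]\<^bsub>U\<^esub> b i) \<in> W"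
  shows "(\<gamma> [^]\<^bsub>U\<^esub> k, \<one>\<^bsub>U\<^esub>) \<in> W" "(\<one>\<^bsub>U\<^esub>, \<gamma> [^]\<^bsub>U\<^esub> k) \<in> W"
proof -
  interpret U: group U by fact
  interpret UU: group "U \<times>\<times> U" using U U by (rule DirProd_group)
  interpret W: subgroup W "U \<times>\<times> U" by fact
  \<comment> \<open>Relations are tracked on exponents: \<open>P\<close> is an additive subgroup of
    pairs of integers, and \<open>step\<close> puts \<open>(b (i + 1), b i)\<close> into it.\<close>
  define P where "P = {(k :: int, l :: int). (\<gamma> [^]\<^bsub>U\<^esub> k, \<gamma> [^]\<^bsub>U\<^esub> l) \<in> W}"
  have P0: "(0, 0) \<in> P" using W.one_closed by (simp add: P_def)
  have Padd: "(k + k', l + l') \<in> P" if "(k, l) \<in> P" "(k', l') \<in> P" for k l k' l'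
    using that W.m_closed[of "(\<gamma> [^]\<^bsub>U\<^esub> k, \<gamma> [^]\<^bsub>U\<^esub> l)" "(\<gamma> [^]\<^bsub>U\<^esub> k', \<gamma> [^]\<^bsub>U\<^esub> l')"] \<gamma>
    by (simp add: P_def U.int_pow_mult)
  have Pneg: "(- k, - l) \<in> P" if "(k, l) \<in> P" for k l
    using that W.m_inv_closed[of "(\<gamma> [^]\<^bsub>U\<^esub> k, \<gamma> [^]\<^bsub>U\<^esub> l)"] \<gamma> U
    by (simp add: P_def U.int_pow_neg)
  have Pmul_nat: "(int m * k, int m * l) \<in> P" if "(k, l) \<in> P" for k l m
    using that P0 by (induction m) (auto simp: algebra_simps intro: Padd)
  have Pmul: "(m * k, m * l) \<in> P" if "(k, l) \<in> P" for k l m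
    using Pmul_nat[OF that, of "nat \<bar>m\<bar>"] Pneg[OF Pmul_nat[OF that, of "nat \<bar>m\<bar>"]]
    by (cases "m \<ge> 0") simp_all
  have rel: "(m * b (Suc i), m * b i) \<in> P" for i m
  proof (cases "i \<le> n")
    case True
    then show ?thesis using step by (intro Pmul) (simp add: P_def)
  next
    case False
    then show ?thesis using b(2) P0 by simp
  qed
  have 1: "(b i * b j, 0) \<in> P" for i j
  proof (induction j arbitrary: i)
    case 0
    then show ?case using P0 b by simp
  next
    case (Suc j)
    \<comment> \<open>The sum of these two pairs is
      \<open>(b i * b (j + 1) - b j * b (i + 1), 0)\<close>; the induction hypothesis at
      \<open>i + 1\<close> cancels the subtracted term, so \<open>i\<close> must stay
      arbitrary.\<close>
    have "(b i * b (Suc j), b i * b j) \<in> P" "(- (b j * b (Suc i)), - (b j * b i)) \<in> P"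
      using rel Pneg by blast+
    from Padd[OF Padd[OF this] Suc.IH[of "Suc i"]] show ?case by (simp add: mult.commute)
  qed
  have 2: "(0, b i * b j) \<in> P" for i j
    using Padd[OF rel[of "b i" j] Pneg[OF 1[of i "Suc j"]]] by simp
  \<comment> \<open>This is Gauss's lemma for contents. A generator of an ideal containing all
    \<open>b i * b j\<close> divides, for each fixed \<open>i\<close>, their gcd over
    \<open>j\<close>, which is \<open>b i\<close> up to sign; hence it divides the gcd of all
    \<open>b i\<close>, which is 1.\<close>
  have all: "1 \<in> D" if D: "0 \<in> D" "\<And>a b. a \<in> D \<Longrightarrow> b \<in> D \<Longrightarrow> a - b \<in> D" "\<And>a k. a \<in> D \<Longrightarrow> k * a \<in> D"
    and bb: "\<And>i j. b i * b j \<in> D" for D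
  proof -
    obtain d where d: "d \<in> D" "\<And>x. x \<in> D \<Longrightarrow> d dvd x"
      using int_ideal_principal[of D] D by metis
    have "d dvd b i" for i
    proof -
      have "d dvd Gcd ((*) (b i) ` range b)" using d bb by (intro Gcd_greatest) auto
      then show ?thesis using b(3) by (simp add: Gcd_mult)
    qed
    then have "d dvd Gcd (range b)" by (intro Gcd_greatest) auto
    then show ?thesis using d(1) D(3) b(3) by (metis dvdE mult.commute)
  qed
  have Pdiff: "(k - k', l - l') \<in> P" if "(k, l) \<in> P" "(k', l') \<in> P" for k l k' l'
    using Padd[OF that(1) Pneg[OF that(2)]] by simp
  have "1 \<in> {k. (k, 0) \<in> P}"
  proof (rule all)
    show "a - b \<in> {k. (k, 0) \<in> P}" if "a \<in> {k. (k, 0) \<in> P}" "b \<in> {k. (k, 0) \<in> P}" for a b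
      using Pdiff[of a 0 b 0] that by simp
    show "k * a \<in> {k. (k, 0) \<in> P}" if "a \<in> {k. (k, 0) \<in> P}" for a k
      using Pmul[of a 0 k] that by simp
  qed (simp_all add: P0 1)
  moreover have "1 \<in> {k. (0, k) \<in> P}"
  proof (rule all)
    show "a - b \<in> {k. (0, k) \<in> P}" if "a \<in> {k. (0, k) \<in> P}" "b \<in> {k. (0, k) \<in> P}" for a b
      using Pdiff[of 0 a 0 b] that by simp
    show "k * a \<in> {k. (0, k) \<in> P}" if "a \<in> {k. (0, k) \<in> P}" for a k
      using Pmul[of 0 a k] that by simp
  qed (simp_all add: P0 2)
  ultimately have "(k, 0) \<in> P" "(0, k) \<in> P" for k using Pmul[of 1 0 k] Pmul[of 0 1 k] by simp_all
  then show "(\<gamma> [^]\<^bsub>U\<^esub> k, \<one>\<^bsub>U\<^esub>) \<in> W" "(\<one>\<^bsub>U\<^esub>, \<gamma> [^]\<^bsub>U\<^esub> k) \<in> W"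
    by (simp_all add: P_def)
qed

text \<open>With \<open>U\<close> cyclic, the entries become exponents of one element
  \<open>\<gamma>\<close>; dividing these by their gcd replaces \<open>\<gamma>\<close> by a power
  of it and makes \<open>staircase_subgroup\<close> applicable.\<close>

lemma staircase_subgroup_cyclic:
  fixes n :: nat and a :: "nat \<Rightarrow> 'a"
  assumes U: "group U" and W: "subgroup W (U \<times>\<times> U)"
    and \<gamma>: "\<gamma> \<in> carrier U" "carrier U = range (\<lambda>k::nat. \<gamma> [^]\<^bsub>U\<^esub> k)"
    and a: "\<And>i. i \<in> {1..n} \<Longrightarrow> a i \<in> carrier U"
    and first: "(a 1, \<one>\<^bsub>U\<^esub>) \<in> W" and last: "(\<one>\<^bsub>U\<^esub>, a n) \<in> W"
    and step: "\<And>i. i \<in> {1..<n} \<Longrightarrow> (a (Suc i), a i) \<in> W"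
    and i: "i \<in> {1..n}"
  shows "(a i, \<one>\<^bsub>U\<^esub>) \<in> W" "(\<one>\<^bsub>U\<^esub>, a i) \<in> W"
proof -
  interpret U: group U by fact
  interpret W: subgroup W "U \<times>\<times> U" by fact
  have "\<exists>k::nat. a i = \<gamma> [^]\<^bsub>U\<^esub> k" if "i \<in> {1..n}" for i
    using a[OF that] \<gamma>(2) by auto
  then obtain c0 :: "nat \<Rightarrow> nat" where c0: "\<And>i. i \<in> {1..n} \<Longrightarrow> a i = \<gamma> [^]\<^bsub>U\<^esub> c0 i" by metis
  \<comment> \<open>The value 0 outside \<open>{1..n}\<close> turns the boundary pairs
    \<open>first\<close> and \<open>last\<close> into the steps \<open>i = 0\<close> and
    \<open>i = n\<close> of the same pattern.\<close>
  define c where "c i = (if i \<in> {1..n} then int (c0 i) else 0)" for i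
  have c: "a i = \<gamma> [^]\<^bsub>U\<^esub> c i" if "i \<in> {1..n}" for i
    using c0[OF that] that by (simp add: c_def int_pow_int)
  have stepc: "(\<gamma> [^]\<^bsub>U\<^esub> c (Suc i), \<gamma> [^]\<^bsub>U\<^esub> c i) \<in> W" if "i \<le> n" for i
  proof -
    have n: "n \<ge> 1" using i by simp
    consider "i = 0" | "i = n" "i \<noteq> 0" | "i \<in> {1..<n}"
      using \<open>i \<le> n\<close> by fastforce
    then show ?thesis
    proof cases
      case 1 then show ?thesis using first n c[of 1] by (simp add: c_def)
    next
      case 2 then show ?thesis using last n c[of n] by (simp add: c_def)
    next
      case 3 then show ?thesis using step[of i] c[of i] c[of "Suc i"] by simp
    qed
  qed
  define g where "g = Gcd (range c)"
  have gc: "c i = g * (c i div g)" for i unfolding g_def by simp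
  have "(\<gamma> [^]\<^bsub>U\<^esub> c i, \<one>\<^bsub>U\<^esub>) \<in> W \<and> (\<one>\<^bsub>U\<^esub>, \<gamma> [^]\<^bsub>U\<^esub> c i) \<in> W"
  proof (cases "g = 0")
    case True
    then show ?thesis using gc[of i] W.one_closed by simp
  next
    case False
    define b where "b i = c i div g" for i
    \<comment> \<open>\<open>?\<delta>\<close> generates the subgroup generated by all the entries;
      with respect to it the exponents are the coprime \<open>b i\<close>.\<close>
    let ?\<delta> = "\<gamma> [^]\<^bsub>U\<^esub> g"
    have pow: "\<gamma> [^]\<^bsub>U\<^esub> c i = ?\<delta> [^]\<^bsub>U\<^esub> b i" for i
      unfolding U.int_pow_pow[OF \<gamma>(1)] b_def gc[symmetric] ..
    have "g = Gcd ((*) g ` range b)" unfolding image_image b_def gc[symmetric] by (simp add: g_def)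
    then have "Gcd (range b) = 1" using False by (simp add: Gcd_mult g_def)
    moreover have "b 0 = 0" "\<And>i. i > n \<Longrightarrow> b i = 0"
      by (simp_all add: b_def c_def)
    moreover have "(?\<delta> [^]\<^bsub>U\<^esub> b (Suc i), ?\<delta> [^]\<^bsub>U\<^esub> b i) \<in> W" if "i \<le> n" for i
      using stepc[OF that] by (simp only: pow)
    moreover have "?\<delta> \<in> carrier U" using \<gamma>(1) by simp
    ultimately have "(?\<delta> [^]\<^bsub>U\<^esub> k, \<one>\<^bsub>U\<^esub>) \<in> W \<and> (\<one>\<^bsub>U\<^esub>, ?\<delta> [^]\<^bsub>U\<^esub> k) \<in> W" for k :: int
      using staircase_subgroup[OF U W, of ?\<delta> b n k] by blast
    then show ?thesis by (simp add: pow)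
  qed
  then show "(a i, \<one>\<^bsub>U\<^esub>) \<in> W" "(\<one>\<^bsub>U\<^esub>, a i) \<in> W" using c[OF i] by simp_all
qed

section \<open>The ring \<open>Z_inv\<close> and its units\<close>

lemma Z_inv_simps [simp]:
  "x \<otimes>\<^bsub>Z_inv \<Sigma>\<^esub> y = x * y" "\<one>\<^bsub>Z_inv \<Sigma>\<^esub> = 1" "\<zero>\<^bsub>Z_inv \<Sigma>\<^esub> = 0" "x \<oplus>\<^bsub>Z_inv \<Sigma>\<^esub> y = x + y"
  by (simp_all add: Z_inv_def)

lemma Z_inv_memI:
  "b > 0 \<Longrightarrow> prime_factors b \<subseteq> \<Sigma> \<Longrightarrow> of_int a / of_nat b \<in> carrier (Z_inv \<Sigma>)"
  by (auto simp: Z_inv_def)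

lemma Z_inv_memE:
  assumes "x \<in> carrier (Z_inv \<Sigma>)"
  obtains a b where "x = of_int a / of_nat b" "b > 0" "prime_factors b \<subseteq> \<Sigma>"
  using assms by (auto simp: Z_inv_def)

lemma Z_inv_of_int: "of_int a \<in> carrier (Z_inv \<Sigma>)"
  using Z_inv_memI[of 1 \<Sigma> a] by simp

lemma Z_inv_closed:
  assumes "x \<in> carrier (Z_inv \<Sigma>)" "y \<in> carrier (Z_inv \<Sigma>)"
  shows "x + y \<in> carrier (Z_inv \<Sigma>)" "x * y \<in> carrier (Z_inv \<Sigma>)"
proof -
  obtain a b where x: "x = of_int a / of_nat b" "b > 0" "prime_factors b \<subseteq> \<Sigma>"
    using assms(1) by (rule Z_inv_memE)
  obtain c d where y: "y = of_int c / of_nat d" "d > 0" "prime_factors d \<subseteq> \<Sigma>"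
    using assms(2) by (rule Z_inv_memE)
  have bd: "b * d > 0" "prime_factors (b * d) \<subseteq> \<Sigma>" using x y by (simp_all add: prime_factors_product)
  have "x + y = of_int (a * int d + c * int b) / of_nat (b * d)" "x * y = of_int (a * c) / of_nat (b * d)"
    using x y by (simp_all add: field_simps)
  then show "x + y \<in> carrier (Z_inv \<Sigma>)" "x * y \<in> carrier (Z_inv \<Sigma>)"
    by (simp_all only: Z_inv_memI[OF bd])
qed

lemma Z_inv_cring: "cring (Z_inv \<Sigma>)"
proof (rule cringI)
  have 0: "0 \<in> carrier (Z_inv \<Sigma>)" "1 \<in> carrier (Z_inv \<Sigma>)" "- 1 \<in> carrier (Z_inv \<Sigma>)"
    using Z_inv_of_int[of 0] Z_inv_of_int[of 1] Z_inv_of_int[of "-1"] by simp_all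
  have "\<exists>y\<in>carrier (Z_inv \<Sigma>). y + x = 0" if "x \<in> carrier (Z_inv \<Sigma>)" for x
    using Z_inv_closed(2)[OF 0(3) that] by (intro bexI[of _ "-x"]) auto
  then show "abelian_group (Z_inv \<Sigma>)"
    by (intro abelian_groupI) (auto simp: Z_inv_closed 0)
  show "Group.comm_monoid (Z_inv \<Sigma>)"
    by (intro comm_monoidI) (auto simp: Z_inv_closed 0)
qed (auto simp: algebra_simps)

lemma Z_inv_Units_iff:
  "x \<in> Units (Z_inv \<Sigma>) \<longleftrightarrow> x \<noteq> 0 \<and> x \<in> carrier (Z_inv \<Sigma>) \<and> inverse x \<in> carrier (Z_inv \<Sigma>)"
proof
  assume "x \<in> Units (Z_inv \<Sigma>)"
  then obtain y where "x \<in> carrier (Z_inv \<Sigma>)" "y \<in> carrier (Z_inv \<Sigma>)" "x * y = 1"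
    by (auto simp: Units_def)
  then show "x \<noteq> 0 \<and> x \<in> carrier (Z_inv \<Sigma>) \<and> inverse x \<in> carrier (Z_inv \<Sigma>)"
    using inverse_unique[of x y] by auto
qed (auto simp: Units_def intro!: bexI[of _ "inverse x"])

lemma Gm2_simps [simp]:
  "carrier (Gm2 R) = Units R \<times> Units R" "\<one>\<^bsub>Gm2 R\<^esub> = (\<one>\<^bsub>R\<^esub>, \<one>\<^bsub>R\<^esub>)"
  "x \<otimes>\<^bsub>Gm2 R\<^esub> y = (fst x \<otimes>\<^bsub>R\<^esub> fst y, snd x \<otimes>\<^bsub>R\<^esub> snd y)"
  by (simp_all add: Gm2_def units_of_def mult_DirProd')

text \<open>Both \<open>rat_val\<close> and \<open>reduce\<close> are defined through the reduced
  fraction; cross-multiplication lets them be computed from any fraction. The reduced denominator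
  divides \<open>b\<close> because it is coprime to the numerator.\<close>

lemma quotient_of_fraction:
  assumes "x = of_int a / of_int b" "b \<noteq> 0"
  shows "fst (quotient_of x) * b = a * snd (quotient_of x)"
    and "snd (quotient_of x) dvd b"
proof -
  obtain m d where q: "quotient_of x = (m, d)" by fastforce
  have d: "d > 0" "coprime m d" "x = of_int m / of_int d"
    using quotient_of_denom_pos[OF q] quotient_of_coprime[OF q] quotient_of_div[OF q] by auto
  then have "of_int (m * b) = (of_int (a * d) :: rat)" using assms by (simp add: field_simps)
  then have eq: "m * b = a * d" by (simp only: of_int_eq_iff)
  then show "fst (quotient_of x) * b = a * snd (quotient_of x)" using q by simp
  have "d dvd m * b" using eq by simp
  then show "snd (quotient_of x) dvd b"
    using d(2) q by (simp add: coprime_dvd_mult_right_iff coprime_commute)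
qed

section \<open>Valuations of positive units\<close>

text \<open>For prime \<open>l\<close> this is the \<open>l\<close>-adic valuation, with the default
  value 0 at \<open>x = 0\<close>.\<close>

definition rat_val :: "nat \<Rightarrow> rat \<Rightarrow> int" where
  "rat_val l x = int (multiplicity (int l) (fst (quotient_of x))) - int (multiplicity (int l) (snd (quotient_of x)))"

text \<open>Taking multiplicities in the cross-multiplied equation \<open>m * b = a * d\<close>
  shows independence of the chosen fraction.\<close>

lemma rat_val_fraction:
  assumes "prime l" "a \<noteq> 0" "b \<noteq> 0"
  shows "rat_val l (of_int a / of_int b) = int (multiplicity (int l) a) - int (multiplicity (int l) b)"
proof -
  obtain m d where q: "quotient_of (of_int a / of_int b) = (m, d)" by fastforce
  have eq: "m * b = a * d" using quotient_of_fraction(1)[OF refl assms(3), of a] q by simp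
  have d: "d > 0" using quotient_of_denom_pos[OF q] .
  then have "m \<noteq> 0" using eq assms by auto
  have "multiplicity (int l) (m * b) = multiplicity (int l) (a * d)" by (simp only: eq)
  then have "multiplicity (int l) m + multiplicity (int l) b = multiplicity (int l) a + multiplicity (int l) d"
    using assms d \<open>m \<noteq> 0\<close> by (simp add: prime_elem_multiplicity_mult_distrib)
  then show ?thesis using q by (simp add: rat_val_def)
qed

lemma rat_val_mult:
  assumes "prime l" "x \<noteq> 0" "y \<noteq> 0"
  shows "rat_val l (x * y) = rat_val l x + rat_val l y"
proof -
  have "\<exists>a b. x = of_int a / of_int b \<and> a \<noteq> 0 \<and> b \<noteq> 0" if "x \<noteq> 0" for x :: rat
    using that quotient_of_div[of x "fst (quotient_of x)" "snd (quotient_of x)"]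
      quotient_of_denom_pos'[of x] by (intro exI[of _ "fst (quotient_of x)"] exI[of _ "snd (quotient_of x)"]) auto
  then obtain a b c d where *: "x = of_int a / of_int b" "y = of_int c / of_int d"
    "a \<noteq> 0" "b \<noteq> 0" "c \<noteq> 0" "d \<noteq> 0" using assms by metis
  have "x * y = of_int (a * c) / of_int (b * d)" using * by simp
  then show ?thesis
    using * assms rat_val_fraction[of l "a * c" "b * d"]
    by (simp add: rat_val_fraction prime_elem_multiplicity_mult_distrib)
qed

lemma prime_dvd_snd_quotient_of:
  assumes "x \<in> carrier (Z_inv \<Sigma>)" "prime l" "int l dvd snd (quotient_of x)"
  shows "l \<in> \<Sigma>"
proof -
  obtain a b where x: "x = of_int a / of_nat b" "b > 0" "prime_factors b \<subseteq> \<Sigma>"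
    using assms(1) by (rule Z_inv_memE)
  have "snd (quotient_of x) dvd int b" using x by (intro quotient_of_fraction(2)[of x a]) simp_all
  then have "l dvd b" using assms(3) dvd_trans int_dvd_int_iff by blast
  then show ?thesis using x assms(2) by (auto simp: in_prime_factors_iff)
qed

text \<open>Primes dividing the numerator or denominator of a unit lie in \<open>\<Sigma>\<close>,
  where vanishing of the valuation makes them divide both or neither; as these are coprime, no prime
  divides either. Positivity excludes -1.\<close>

lemma Z_inv_unit_eq_1:
  assumes x: "x \<in> Units (Z_inv \<Sigma>)" "x > 0" and v: "\<And>l. l \<in> \<Sigma> \<Longrightarrow> prime l \<Longrightarrow> rat_val l x = 0"
  shows "x = 1"
proof -
  obtain m d where q: "quotient_of x = (m, d)" by fastforce
  have d: "d > 0" "coprime m d" "x = of_int m / of_int d"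
    using quotient_of_denom_pos[OF q] quotient_of_coprime[OF q] quotient_of_div[OF q] by auto
  have m: "m > 0" using x(2) d by (simp add: zero_less_divide_iff)
  \<comment> \<open>Inversion swaps numerator and denominator, so the primes of the numerator are
    controlled by the denominator of \<open>inverse x\<close>.\<close>
  have "quotient_of (inverse x) = (d, m)"
    unfolding rat_inverse_code q using m by simp
  then have m\<Sigma>: "l \<in> \<Sigma>" if "prime l" "int l dvd m" for l
    using prime_dvd_snd_quotient_of[of "inverse x" \<Sigma> l] x(1) that by (simp add: Z_inv_Units_iff)
  have d\<Sigma>: "l \<in> \<Sigma>" if "prime l" "int l dvd d" for l
    using prime_dvd_snd_quotient_of[of x \<Sigma> l] x(1) that q by (simp add: Z_inv_Units_iff)
  have no: False if "prime l" "int l dvd m * d" for l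
  proof -
    have p: "prime (int l)" using that(1) by simp
    have "l \<in> \<Sigma>" using that p m\<Sigma> d\<Sigma> prime_dvd_multD by blast
    then have "multiplicity (int l) m = multiplicity (int l) d"
      using v[of l] that(1) q by (simp add: rat_val_def)
    then have "int l dvd m \<longleftrightarrow> int l dvd d"
      using p m d(1) by (metis multiplicity_eq_zero_iff not_prime_unit order_less_irrefl)
    then have "int l dvd m" "int l dvd d" using that(2) p prime_dvd_multD by blast+
    then show False using d(2) p by (meson coprime_common_divisor not_prime_unit)
  qed
  have "nat (m * d) = 1"
  proof (rule ccontr)
    assume "nat (m * d) \<noteq> 1"
    then obtain l where l: "prime l" "l dvd nat (m * d)" using prime_factor_nat by blast
    then have "int l dvd m * d" using m d(1) by (simp add: nat_dvd_iff int_dvd_int_iff flip: int_dvd_int_iff)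
    then show False using no l by blast
  qed
  then have "m * d = 1" using m d by (simp add: nat_eq_iff)
  then show ?thesis using m d by (simp add: zmult_eq_1_iff)
qed

text \<open>Positivity removes the torsion coming from -1, the only obstruction to joint injectivity
  of the valuations.\<close>

lemma positive_subgroup:
  "subgroup {x \<in> carrier (Gm2 (Z_inv \<Sigma>)). fst x > 0 \<and> snd x > 0} (Gm2 (Z_inv \<Sigma>))"
proof -
  interpret comm_group "Gm2 (Z_inv \<Sigma>)" by (rule Gm2_comm_group[OF Z_inv_cring])
  show ?thesis
  proof (rule subgroupI)
    show "{x \<in> carrier (Gm2 (Z_inv \<Sigma>)). fst x > 0 \<and> snd x > 0} \<noteq> {}"
      using one_closed by (auto intro!: exI[of _ 1])
    fix x assume x: "x \<in> {x \<in> carrier (Gm2 (Z_inv \<Sigma>)). fst x > 0 \<and> snd x > 0}"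
    then have c: "x \<in> carrier (Gm2 (Z_inv \<Sigma>))" by simp
    have "fst x * fst (inv\<^bsub>Gm2 (Z_inv \<Sigma>)\<^esub> x) = 1" "snd x * snd (inv\<^bsub>Gm2 (Z_inv \<Sigma>)\<^esub> x) = 1"
      using r_inv[OF c] by simp_all
    then have "fst (inv\<^bsub>Gm2 (Z_inv \<Sigma>)\<^esub> x) > 0 \<and> snd (inv\<^bsub>Gm2 (Z_inv \<Sigma>)\<^esub> x) > 0"
      using x by (metis (mono_tags, lifting) mem_Collect_eq zero_less_mult_pos zero_less_one)
    then show "inv\<^bsub>Gm2 (Z_inv \<Sigma>)\<^esub> x \<in> {x \<in> carrier (Gm2 (Z_inv \<Sigma>)). fst x > 0 \<and> snd x > 0}"
      using inv_closed[OF c] by blast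
  next
    fix x y
    assume "x \<in> {x \<in> carrier (Gm2 (Z_inv \<Sigma>)). fst x > 0 \<and> snd x > 0}"
      "y \<in> {x \<in> carrier (Gm2 (Z_inv \<Sigma>)). fst x > 0 \<and> snd x > 0}"
    then show "x \<otimes>\<^bsub>Gm2 (Z_inv \<Sigma>)\<^esub> y \<in> {x \<in> carrier (Gm2 (Z_inv \<Sigma>)). fst x > 0 \<and> snd x > 0}"
      using m_closed[of x y] by auto
  qed auto
qed

section \<open>Reduction modulo a prime\<close>

lemma residues_F_p: "prime q \<Longrightarrow> residues (int q)"
  using prime_gt_1_int[of "int q"] by (simp add: residues_def)

lemma F_p_cring: "prime q \<Longrightarrow> cring (F_p q)"
  unfolding F_p_def by (rule residues.cring[OF residues_F_p])

text \<open>Reduction may be read off from any fraction with denominator prime to \<open>q\<close>: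
  cross-multiplication with the reduced fraction gives the congruence up to the factor
  \<open>d\<close>, which is invertible modulo \<open>q\<close>.\<close>

lemma reduce_fraction:
  assumes q: "prime q" and x: "x = of_int a / of_int b" "\<not> int q dvd b"
  shows "reduce q x \<in> carrier (F_p q)" "(reduce q x * b) mod int q = a mod int q"
proof -
  interpret residues "int q" "F_p q" unfolding F_p_def by (rule residues_F_p[OF q]) 
  interpret residues_prime q "F_p q"
    using q by unfold_locales (simp_all add: F_p_def)
  obtain m d where qd: "quotient_of x = (m, d)" by fastforce
  have b0: "b \<noteq> 0" using x(2) by auto
  have eq: "m * b = a * d" and "d dvd b" using quotient_of_fraction[OF x(1) b0] qd by simp_all
  then have nd: "\<not> int q dvd d" using x(2) dvd_trans by blast
  \<comment> \<open>The residue of \<open>d\<close> lies between 1 and \<open>q - 1\<close>, so the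
    inverse in the definition of \<open>reduce\<close> is a genuine one.\<close>
  then have u: "d mod int q \<in> Units (F_p q)"
    using prime_gt_0_nat[OF q] pos_mod_bound[of "int q" d] pos_mod_sign[of "int q" d] mod_0_imp_dvd[of d "int q"]
    unfolding res_prime_units_eq atLeastAtMost_iff by linarith
  let ?i = "inv\<^bsub>F_p q\<^esub> (d mod int q)"
  have r: "reduce q x = (m mod int q) \<otimes>\<^bsub>F_p q\<^esub> ?i" by (simp add: reduce_def qd)
  show "reduce q x \<in> carrier (F_p q)"
    unfolding r using Units_inv_closed[OF u] by (intro m_closed) (simp_all add: mod_in_carrier)
  have i: "(?i * (d mod int q)) mod int q = 1"
    using Units_l_inv[OF u] by (simp add: res_mult_eq res_one_eq)
  have "[reduce q x = m * ?i] (mod int q)"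
    unfolding r res_mult_eq cong_def by (simp add: mod_mult_left_eq)
  then have "[reduce q x * d = m * ?i * (d mod int q)] (mod int q)"
    by (rule cong_mult) (simp add: cong_def)
  also have "m * ?i * (d mod int q) = m * (?i * (d mod int q))" by (simp only: mult.assoc)
  also have "[m * (?i * (d mod int q)) = m * 1] (mod int q)"
    using i m_gt_one by (intro cong_mult cong_refl) (simp add: cong_def)
  finally have "[reduce q x * d = m] (mod int q)" by simp
  then have "[reduce q x * d * b = a * d] (mod int q)"
    unfolding eq[symmetric] by (intro cong_mult cong_refl)
  then have "[d * (reduce q x * b) = d * a] (mod int q)" by (simp add: mult_ac)
  moreover have "coprime d (int q)"
    using nd q prime_imp_coprime[of "int q" d] by (simp add: coprime_commute)
  ultimately show "(reduce q x * b) mod int q = a mod int q"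
    unfolding cong_def[symmetric] by (simp add: cong_mult_lcancel)
qed

text \<open>Since \<open>b\<close> is invertible modulo \<open>q\<close>, the congruence has only
  one solution among the residues. Multiplicativity of \<open>reduce\<close> follows from this
  without unfolding \<open>quotient_of\<close>.\<close>

lemma reduce_unique:
  assumes q: "prime q" and x: "x = of_int a / of_int b" "\<not> int q dvd b"
    and y: "y \<in> carrier (F_p q)" "(y * b) mod int q = a mod int q"
  shows "reduce q x = y"
proof -
  interpret residues "int q" "F_p q" unfolding F_p_def by (rule residues_F_p[OF q]) 
  have "coprime b (int q)"
    using x(2) q prime_imp_coprime[of "int q" b] by (simp add: coprime_commute)
  then have "[reduce q x = y] (mod int q)"
    using reduce_fraction(2)[OF q x] y(2) by (metis cong_def cong_mult_rcancel)
  then show ?thesis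
    using reduce_fraction(1)[OF q x] y(1) by (simp add: cong_def res_carrier_eq)
qed

lemma reduce_1: "prime q \<Longrightarrow> reduce q 1 = \<one>\<^bsub>F_p q\<^esub>"
  using prime_gt_1_nat[of q] by (intro reduce_unique[of q 1 1 1]) (auto simp: F_p_def residue_ring_def)

lemma Z_inv_prime_memE:
  assumes "x \<in> carrier (Z_inv \<Sigma>)" "prime q" "q \<notin> \<Sigma>"
  obtains a b where "x = of_int a / of_int b" "\<not> int q dvd b"
proof -
  obtain a b where x: "x = of_int a / of_nat b" "b > 0" "prime_factors b \<subseteq> \<Sigma>"
    using assms(1) by (rule Z_inv_memE)
  have "\<not> q dvd b" using x assms by (auto simp: in_prime_factors_iff)
  then show ?thesis using that[of a "int b"] x by simp
qed

lemma reduce_mult: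
  assumes q: "prime q" "q \<notin> \<Sigma>" and xy: "x \<in> carrier (Z_inv \<Sigma>)" "y \<in> carrier (Z_inv \<Sigma>)"
  shows "reduce q (x * y) = reduce q x \<otimes>\<^bsub>F_p q\<^esub> reduce q y"
proof -
  interpret residues "int q" "F_p q" unfolding F_p_def by (rule residues_F_p[OF q(1)]) 
  obtain a b where x: "x = of_int a / of_int b" "\<not> int q dvd b" using xy(1) q by (rule Z_inv_prime_memE)
  obtain c d where y: "y = of_int c / of_int d" "\<not> int q dvd d" using xy(2) q by (rule Z_inv_prime_memE)
  show ?thesis
  proof (rule reduce_unique[OF q(1)])
    show "x * y = of_int (a * c) / of_int (b * d)" using x y by simp
    show "\<not> int q dvd b * d" using x y q(1) by (simp add: prime_dvd_mult_iff)
    show "reduce q x \<otimes>\<^bsub>F_p q\<^esub> reduce q y \<in> carrier (F_p q)"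
      using reduce_fraction(1)[OF q(1)] x y by simp
    have "[(reduce q x * b) * (reduce q y * d) = a * c] (mod int q)"
      using reduce_fraction(2)[OF q(1)] x y by (intro cong_mult) (simp_all add: cong_def)
    then show "(reduce q x \<otimes>\<^bsub>F_p q\<^esub> reduce q y) * (b * d) mod int q = a * c mod int q"
      unfolding cong_def res_mult_eq mod_mult_left_eq by (simp only: mult_ac)
  qed
qed

lemma reduce_unit:
  assumes q: "prime q" "q \<notin> \<Sigma>" and x: "x \<in> Units (Z_inv \<Sigma>)"
  shows "reduce q x \<in> Units (F_p q)"
proof -
  interpret residues "int q" "F_p q" unfolding F_p_def by (rule residues_F_p[OF q(1)]) 
  have c: "reduce q z \<in> carrier (F_p q)" if "z \<in> carrier (Z_inv \<Sigma>)" for z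
    using Z_inv_prime_memE[OF that q] reduce_fraction(1)[OF q(1)] by metis
  have "reduce q x \<otimes>\<^bsub>F_p q\<^esub> reduce q (inverse x) = \<one>\<^bsub>F_p q\<^esub>"
    using x reduce_mult[OF q, of x "inverse x"] reduce_1[OF q(1)] by (simp add: Z_inv_Units_iff)
  moreover have "reduce q x \<in> carrier (F_p q)" "reduce q (inverse x) \<in> carrier (F_p q)"
    using c x unfolding Z_inv_Units_iff by blast+
  ultimately show ?thesis
    using m_comm[of "reduce q x" "reduce q (inverse x)"] unfolding Units_def by auto
qed

lemma r_p_hom:
  assumes "prime q" "q \<notin> \<Sigma>"
  shows "r_p q \<in> hom (Gm2 (Z_inv \<Sigma>)) (Gm2 (F_p q))"
  using assms by (intro homI) (auto simp: r_p_def reduce_unit reduce_mult[OF assms] Z_inv_Units_iff)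

text \<open>The multiplicative group of a finite field is cyclic. Powers are taken in
  \<open>units_of\<close> with natural exponents, as \<open>staircase_subgroup_cyclic\<close>
  expects.\<close>

lemma F_p_cyclic:
  assumes "prime q"
  obtains \<gamma> where "\<gamma> \<in> Units (F_p q)" "Units (F_p q) = range (\<lambda>k::nat. \<gamma> [^]\<^bsub>units_of (F_p q)\<^esub> k)"
proof -
  interpret residues_prime q "F_p q"
    using assms by unfold_locales (simp_all add: F_p_def)
  interpret field "F_p q" by (rule is_field)
  obtain \<gamma> where \<gamma>: "\<gamma> \<in> carrier (mult_of (F_p q))"
    "carrier (mult_of (F_p q)) = {\<gamma> [^]\<^bsub>F_p q\<^esub> i | i::nat. i \<in> UNIV}"
    using finite_field_mult_group_has_gen finite by blast
  have U: "carrier (mult_of (F_p q)) = Units (F_p q)"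
    by (simp add: field_Units)
  have "\<gamma> \<in> Units (F_p q)" using \<gamma>(1) unfolding U .
  moreover from this have "Units (F_p q) = range (\<lambda>k::nat. \<gamma> [^]\<^bsub>units_of (F_p q)\<^esub> k)"
    using \<gamma>(2) unfolding U by (auto simp: units_of_pow)
  ultimately show ?thesis by (rule that)
qed

section \<open>The subgroups \<open>M_grp\<close>, \<open>Lam_grp\<close>, \<open>Gam\<close> and
  their inclusions\<close>

locale prime_families =
  fixes t :: nat and p :: "nat \<Rightarrow> nat \<Rightarrow> nat" and n :: "nat \<Rightarrow> nat"
  assumes primes: "\<And>i j. j \<in> {1..t} \<Longrightarrow> i \<in> {1..n j} \<Longrightarrow> prime (p i j)"
    and n_pos: "\<And>j. j \<in> {1..t} \<Longrightarrow> n j > 0"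
begin

declare upt_Suc [simp del]

abbreviation "\<Sigma> \<equiv> Sigma_set p n t"
abbreviation "A \<equiv> ambient p n t"
abbreviation "Pos \<equiv> {x \<in> carrier A. fst x > 0 \<and> snd x > 0}"

lemma ambient_eq: "A = Gm2 (Z_inv \<Sigma>)"
  by (simp add: ambient_def)

lemma A_comm_group: "comm_group A"
  unfolding ambient_eq by (rule Gm2_comm_group[OF Z_inv_cring])

sublocale A: comm_group A by (rule A_comm_group)

lemma Pos_subgroup: "subgroup Pos A"
  unfolding ambient_eq by (rule positive_subgroup)

lemma prime_unit:
  assumes "j \<in> {1..t}" "i \<in> {1..n j}"
  shows "of_nat (p i j) \<in> Units (Z_inv \<Sigma>)"
proof -
  have p: "prime (p i j)" "p i j \<in> \<Sigma>" using assms primes unfolding Sigma_set_def S_set_def by blast+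
  then have "of_int 1 / of_nat (p i j) \<in> carrier (Z_inv \<Sigma>)"
    by (intro Z_inv_memI) (simp_all add: prime_gt_0_nat prime_prime_factors)
  then show ?thesis
    using p Z_inv_of_int[of "int (p i j)"] prime_gt_0_nat[OF p(1)]
    by (simp add: Z_inv_Units_iff inverse_eq_divide)
qed

lemma prime_pow_unit:
  assumes "j \<in> {1..t}" "i \<in> {1..n j}"
  shows "of_nat (p i j) ^ k \<in> Units (Z_inv \<Sigma>)"
proof -
  interpret Z: cring "Z_inv \<Sigma>" by (rule Z_inv_cring)
  show ?thesis
    using Z.Units_one_closed Z.Units_m_closed prime_unit[OF assms] by (induction k) simp_all
qed

lemma lam_Pos:
  assumes j: "j \<in> {1..t}"
  shows "lam_first p N j \<in> Pos" "lam_last p n N' j \<in> Pos"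
    and "i \<in> {1..<n j + 2} \<Longrightarrow> lam p n i j \<in> Pos"
proof -
  interpret Z: cring "Z_inv \<Sigma>" by (rule Z_inv_cring)
  have one: "1 \<in> Units (Z_inv \<Sigma>)" using Z.Units_one_closed by simp
  have pos: "p i j > 0" if "i \<in> {1..n j}" for i using primes[OF j that] by (rule prime_gt_0_nat)
  have n1: "1 \<in> {1..n j}" "n j \<in> {1..n j}" using n_pos[OF j] by auto
  show "lam_first p N j \<in> Pos" "lam_last p n N' j \<in> Pos"
    using n1[THEN pos] n1[THEN prime_pow_unit[OF j]] one
    by (simp_all add: ambient_eq lam_first_def lam_last_def)
  show "lam p n i j \<in> Pos" if "i \<in> {1..<n j + 2}"
  proof -
    \<comment> \<open>The cases are the three branches of \<open>lam\<close>; in the middle one both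
      \<open>p i j\<close> and \<open>p (i - 1) j\<close> have to be units.\<close>
    consider "i = 1" | "i \<in> {1..n j}" "i - 1 \<in> {1..n j}" "i \<noteq> 1" | "i = n j + 1" "i \<noteq> 1"
      using \<open>i \<in> {1..<n j + 2}\<close> by fastforce
    then show ?thesis
      using n1[THEN pos] n1[THEN prime_unit[OF j]] one pos[of i] pos[of "i - 1"]
        prime_unit[OF j, of i] prime_unit[OF j, of "i - 1"]
      by cases (simp_all add: ambient_eq lam_def)
  qed
qed

lemma zpowers_lam_subgroup:
  assumes "j \<in> {1..t}" "i \<in> set [1..<n j + 2]"
  shows "subgroup (zpowers A (lam p n i j)) A"
  using zpowers_subgroup[OF A.is_group] lam_Pos(3)[OF assms(1), of i] assms(2) by simp

lemma M_grp_subgroup: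
  assumes "j \<in> {1..t}"
  shows "subgroup (M_grp p n t j) A"
  unfolding M_grp_def using zpowers_lam_subgroup[OF assms]
  by (rule subgroup_prod_subgroup[OF A_comm_group])

lemma lam_in_M_grp:
  assumes "j \<in> {1..t}" "i \<in> {1..<n j + 2}"
  shows "lam p n i j \<in> M_grp p n t j"
proof -
  have "zpowers A (lam p n i j) \<subseteq> M_grp p n t j"
    unfolding M_grp_def using zpowers_lam_subgroup[OF assms(1)] assms(2)
    by (intro subset_subgroup_prod[OF A_comm_group]) simp_all
  then show ?thesis using mem_zpowers[OF A.is_group] lam_Pos(3)[OF assms] by blast
qed

lemma M_grp_Pos: "j \<in> {1..t} \<Longrightarrow> M_grp p n t j \<subseteq> Pos"
  unfolding M_grp_def
  by (intro subgroup_prod_subset[OF Pos_subgroup] zpowers_subset[OF A.is_group Pos_subgroup] lam_Pos(3))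
    simp_all

lemma Lam_grp_subgroup:
  assumes j: "j \<in> {1..t}"
  shows "subgroup (Lam_grp p n N T2 t j) A" "M_grp p n t j \<subseteq> Lam_grp p n N T2 t j"
    and "subgroup (Lam_grp' p n N' T1 t j) A" "M_grp p n t j \<subseteq> Lam_grp' p n N' T1 t j"
proof -
  have Z: "subgroup (zpowers A (lam_first p N j)) A" "subgroup (zpowers A (lam_last p n N' j)) A"
    using lam_Pos(1,2)[OF j] by (auto intro!: zpowers_subgroup A.is_group)
  note M = M_grp_subgroup[OF j]
  show "subgroup (Lam_grp p n N T2 t j) A" "subgroup (Lam_grp' p n N' T1 t j) A"
    using Z M by (simp_all add: Lam_grp_def Lam_grp'_def A.mult_subgroups)
  show "M_grp p n t j \<subseteq> Lam_grp p n N T2 t j" "M_grp p n t j \<subseteq> Lam_grp' p n N' T1 t j"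
    using subset_set_mult(2)[OF A.is_group Z(1) M] subset_set_mult(1)[OF A.is_group M Z(2)]
    by (simp_all add: Lam_grp_def Lam_grp'_def)
qed

lemma Gam_subgroup: "subgroup (Gam p n N T2 t) A" "subgroup (Gam' p n N' T1 t) A"
  unfolding Gam_def Gam'_def
  by (rule subgroup_prod_subgroup[OF A_comm_group]; use Lam_grp_subgroup in auto)+

text \<open>Bounds both groups from above by checking generators; applied to \<open>Pos\<close> and
  to the preimage of the reduction of \<open>M_all\<close>.\<close>

lemma Gam_subset:
  assumes "subgroup L A" "\<And>j. j \<in> {1..t} \<Longrightarrow> M_grp p n t j \<subseteq> L"
    and "\<And>j. j \<in> {1..t} \<Longrightarrow> lam_first p N j \<in> L" "\<And>j. j \<in> {1..t} \<Longrightarrow> lam_last p n N' j \<in> L"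
  shows "Gam p n N T2 t \<subseteq> L" "Gam' p n N' T1 t \<subseteq> L"
proof -
  have "Lam_grp p n N T2 t j \<subseteq> L" "Lam_grp' p n N' T1 t j \<subseteq> L" if "j \<in> {1..t}" for j
    using assms that
    by (simp_all add: Lam_grp_def Lam_grp'_def set_mult_subset_subgroup zpowers_subset[OF A.is_group])
  note * = this
  show "Gam p n N T2 t \<subseteq> L" "Gam' p n N' T1 t \<subseteq> L"
    unfolding Gam_def Gam'_def
    by (rule subgroup_prod_subset[OF assms(1)]; use * in simp)+
qed

definition M_all :: "(rat \<times> rat) set" where
  "M_all = subgroup_prod A (map (M_grp p n t) [1..<t + 1])"

lemma M_all_subgroup: "subgroup M_all A"
  unfolding M_all_def
  by (rule subgroup_prod_subgroup[OF A_comm_group]) (use M_grp_subgroup in auto)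

lemma M_grp_subset_M_all: "j \<in> {1..t} \<Longrightarrow> M_grp p n t j \<subseteq> M_all"
  unfolding M_all_def using M_grp_subgroup by (intro subset_subgroup_prod[OF A_comm_group]) simp_all

text \<open>The factor \<open>M_grp\<close> occurs in \<open>Lam_grp\<close> and
  \<open>Lam_grp'\<close> for every choice of \<open>T1\<close> and \<open>T2\<close>, so
  \<open>M_all\<close> is a common lower bound.\<close>

lemma M_all_subset_Gam: "M_all \<subseteq> Gam p n N T2 t" "M_all \<subseteq> Gam' p n N' T1 t"
proof -
  have "Lam_grp p n N T2 t j \<subseteq> Gam p n N T2 t" "Lam_grp' p n N' T1 t j \<subseteq> Gam' p n N' T1 t"
    if "j \<in> {1..t}" for j
    unfolding Gam_def Gam'_def using Lam_grp_subgroup(1,3) that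
    by (intro subset_subgroup_prod[OF A_comm_group]; simp)+
  then have *: "M_grp p n t j \<subseteq> Gam p n N T2 t" "M_grp p n t j \<subseteq> Gam' p n N' T1 t"
    if "j \<in> {1..t}" for j
    using Lam_grp_subgroup(2,4) that by blast+
  show "M_all \<subseteq> Gam p n N T2 t" "M_all \<subseteq> Gam' p n N' T1 t"
    unfolding M_all_def
    by (rule subgroup_prod_subset[OF Gam_subgroup(1)] subgroup_prod_subset[OF Gam_subgroup(2)];
        use * in simp)+
qed

section \<open>Comparison of the reductions\<close>

text \<open>The reduced generators of \<open>M_grp\<close> form exactly the staircase of
  \<open>staircase_subgroup_cyclic\<close>. So the image contains each reduced prime in either
  coordinate with 1 in the other, and with it the powers occurring in \<open>lam_first\<close> and
  \<open>lam_last\<close>.\<close>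

lemma lam_reduction:
  assumes j: "j \<in> {1..t}" and q: "prime q" "q \<notin> \<Sigma>"
  shows "r_p q (lam_first p N j) \<in> r_p q ` M_grp p n t j"
    and "r_p q (lam_last p n N' j) \<in> r_p q ` M_grp p n t j"
proof -
  let ?U = "units_of (F_p q)" and ?W = "r_p q ` M_grp p n t j"
  interpret F: cring "F_p q" by (rule F_p_cring[OF q(1)])
  interpret T: comm_group "Gm2 (F_p q)" by (rule Gm2_comm_group[OF F.cring_axioms])
  interpret r: group_hom A "Gm2 (F_p q)" "r_p q"
    using r_p_hom[OF q]
    by (intro group_hom.intro group_hom_axioms.intro) (simp_all add: A.is_group T.is_group flip: ambient_eq)
  have W: "subgroup ?W (?U \<times>\<times> ?U)"
    using r.subgroup_img_is_subgroup[OF M_grp_subgroup[OF j]] by (simp add: Gm2_def)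
  obtain \<gamma> where \<gamma>: "\<gamma> \<in> carrier ?U" "carrier ?U = range (\<lambda>k::nat. \<gamma> [^]\<^bsub>?U\<^esub> k)"
    using F_p_cyclic[OF q(1)] by (auto simp: units_of_carrier)
  let ?a = "\<lambda>i. reduce q (of_nat (p i j))"
  have a: "?a i \<in> carrier ?U" if "i \<in> {1..n j}" for i
    using reduce_unit[OF q prime_unit[OF j that]] by (simp add: units_of_carrier)
  have W_lam: "r_p q (lam p n i j) \<in> ?W" if "i \<in> {1..<n j + 2}" for i
    using lam_in_M_grp[OF j that] by (rule imageI)
  have n: "n j > 0" by (rule n_pos[OF j])
  have first: "(?a 1, \<one>\<^bsub>?U\<^esub>) \<in> ?W"
    using W_lam[of 1] n by (simp add: r_p_def lam_def reduce_1[OF q(1)] units_of_one)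
  have last: "(\<one>\<^bsub>?U\<^esub>, ?a (n j)) \<in> ?W"
    using W_lam[of "n j + 1"] n by (simp add: r_p_def lam_def reduce_1[OF q(1)] units_of_one)
  have step: "(?a (Suc i), ?a i) \<in> ?W" if "i \<in> {1..<n j}" for i
    using W_lam[of "Suc i"] that by (simp add: r_p_def lam_def)
  have stair: "(?a i, \<one>\<^bsub>F_p q\<^esub>) \<in> ?W" "(\<one>\<^bsub>F_p q\<^esub>, ?a i) \<in> ?W" if "i \<in> {1..n j}" for i
    using staircase_subgroup_cyclic[of ?U ?W \<gamma> "n j" ?a, OF F.units_group W \<gamma> a first last step that]
    by (simp_all add: units_of_one)
  have mult: "(x \<otimes>\<^bsub>F_p q\<^esub> x', y \<otimes>\<^bsub>F_p q\<^esub> y') \<in> ?W" if "(x, y) \<in> ?W" "(x', y') \<in> ?W" for x y x' y'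
    using subgroup.m_closed[OF W that] by (simp add: units_of_mult)
  have one: "(\<one>\<^bsub>F_p q\<^esub>, \<one>\<^bsub>F_p q\<^esub>) \<in> ?W"
    using subgroup.one_closed[OF W] by (simp add: units_of_one)
  \<comment> \<open>Both coordinates are needed: \<open>lam_first\<close> uses the second one at
    \<open>i = 1\<close>, \<open>lam_last\<close> the first one at \<open>i = n j\<close>.\<close>
  have pow: "(\<one>\<^bsub>F_p q\<^esub>, reduce q (of_nat (p i j) ^ k)) \<in> ?W \<and> (reduce q (of_nat (p i j) ^ k), \<one>\<^bsub>F_p q\<^esub>) \<in> ?W"
    if i: "i \<in> {1..n j}" for i k
  proof (induction k)
    case 0
    then show ?case using one by (simp add: reduce_1[OF q(1)])
  next
    case (Suc k)
    have "reduce q (of_nat (p i j) ^ Suc k) = ?a i \<otimes>\<^bsub>F_p q\<^esub> reduce q (of_nat (p i j) ^ k)"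
      unfolding power_Suc using prime_unit[OF j i] prime_pow_unit[OF j i, of k]
      by (intro reduce_mult[OF q]) (simp_all add: Z_inv_Units_iff)
    then show ?case
      using mult[OF stair(1)[OF i] conjunct2[OF Suc.IH]] mult[OF stair(2)[OF i] conjunct1[OF Suc.IH]]
      by simp
  qed
  show "r_p q (lam_first p N j) \<in> ?W" "r_p q (lam_last p n N' j) \<in> ?W"
    using pow[of 1 "N j"] pow[of "n j" "N' j"] n
    by (simp_all add: r_p_def lam_first_def lam_last_def reduce_1[OF q(1)])
qed

text \<open>The product is the largest of the four groups and \<open>M_all\<close> lies in all of
  them, so this single inclusion settles the equality of all images.\<close>

lemma Gam_reduction:
  assumes q: "prime q" "q \<notin> \<Sigma>"
  shows "subgroup (r_p q ` M_all) (Gm2 (F_p q))"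
    and "r_p q ` (Gam p n N T2 t <#>\<^bsub>A\<^esub> Gam' p n N' T1 t) \<subseteq> r_p q ` M_all"
proof -
  interpret T: comm_group "Gm2 (F_p q)" by (rule Gm2_comm_group[OF F_p_cring[OF q(1)]])
  interpret r: group_hom A "Gm2 (F_p q)" "r_p q"
    using r_p_hom[OF q]
    by (intro group_hom.intro group_hom_axioms.intro) (simp_all add: A.is_group T.is_group flip: ambient_eq)
  show W: "subgroup (r_p q ` M_all) (Gm2 (F_p q))"
    using r.subgroup_img_is_subgroup[OF M_all_subgroup] .
  \<comment> \<open>The preimage of the image of \<open>M_all\<close> is a subgroup, so it suffices
    to check the generators.\<close>
  let ?K = "{x \<in> carrier A. r_p q x \<in> r_p q ` M_all}"
  have K: "subgroup ?K A"
  proof (rule A.subgroupI)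
    have "\<one>\<^bsub>A\<^esub> \<in> ?K"
      using subgroup.one_closed[OF W] unfolding r.hom_one[symmetric] by blast
    then show "?K \<noteq> {}" by blast
  qed (use subgroup.m_closed[OF W] subgroup.m_inv_closed[OF W] in \<open>auto simp del: Gm2_simps\<close>)
  have MK: "M_grp p n t j \<subseteq> ?K" if "j \<in> {1..t}" for j
    using M_grp_subset_M_all[OF that] subgroup.subset[OF M_all_subgroup] by blast
  have LK: "lam_first p N j \<in> ?K" "lam_last p n N' j \<in> ?K" if "j \<in> {1..t}" for j
    using lam_reduction[OF that q] M_grp_subset_M_all[OF that] lam_Pos(1,2)[OF that] by blast+
  have "Gam p n N T2 t <#>\<^bsub>A\<^esub> Gam' p n N' T1 t \<subseteq> ?K"
    by (intro set_mult_subset_subgroup K Gam_subset[where N = N and N' = N'] MK LK)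
  then show "r_p q ` (Gam p n N T2 t <#>\<^bsub>A\<^esub> Gam' p n N' T1 t) \<subseteq> r_p q ` M_all"
    by blast
qed

section \<open>The lattices and the 1-motives\<close>

text \<open>The valuations of both coordinates at the finitely many primes of
  \<open>\<Sigma>\<close> are jointly injective on positive units by
  \<open>Z_inv_unit_eq_1\<close>.\<close>

lemma is_lattice_of_Pos:
  assumes "subgroup \<Gamma> A" "\<Gamma> \<subseteq> Pos"
  shows "is_lattice (A\<lparr>carrier := \<Gamma>\<rparr>)"
proof (rule is_lattice_of_homs)
  \<comment> \<open>The boolean selects the coordinate whose valuation is taken.\<close>
  define \<phi> :: "nat \<times> bool \<Rightarrow> rat \<times> rat \<Rightarrow> int"
    where "\<phi> = (\<lambda>(l, c) x. rat_val l (if c then fst x else snd x))"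
  have \<Sigma>_prime: "prime l" if "l \<in> \<Sigma>" for l
    using that primes by (auto simp: Sigma_set_def S_set_def)
  show "finite (\<Sigma> \<times> (UNIV :: bool set))" by (simp add: Sigma_set_def S_set_def)
  show "comm_group (A\<lparr>carrier := \<Gamma>\<rparr>)" using A_comm_group assms(1) by (rule subgroup_comm_group)
  show "\<phi> i \<in> hom (A\<lparr>carrier := \<Gamma>\<rparr>) integer_group" if "i \<in> \<Sigma> \<times> UNIV" for i
    using that assms(2) \<Sigma>_prime
    by (intro homI) (auto simp: \<phi>_def ambient_eq intro!: rat_val_mult split: prod.splits)
  fix x assume x: "x \<in> carrier (A\<lparr>carrier := \<Gamma>\<rparr>)" and v: "\<And>i. i \<in> \<Sigma> \<times> UNIV \<Longrightarrow> \<phi> i x = 0"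
  have "fst x = 1" "snd x = 1"
    using x assms(2) v[of "(_, True)"] v[of "(_, False)"]
    by (auto simp: \<phi>_def ambient_eq intro!: Z_inv_unit_eq_1[of _ \<Sigma>])
  then show "x = \<one>\<^bsub>A\<lparr>carrier := \<Gamma>\<rparr>\<^esub>" by (simp add: ambient_eq prod_eq_iff)
qed

lemma deligne_of_Pos:
  assumes "subgroup \<Gamma> A" "\<Gamma> \<subseteq> Pos"
  shows "subgroup \<Gamma> (Gm2 (Z_inv \<Sigma>)) \<and> split_deligne_1_motive (Z_inv \<Sigma>)
    (subgroup_motive (Z_inv \<Sigma>) \<Gamma> :: (rat, 'r, rat \<times> rat) toric_motive)"
  using subgroup_motive_diagram[OF Z_inv_cring] is_lattice_of_Pos[OF assms] assms(1)
  unfolding split_deligne_1_motive_def ambient_eq by (auto simp: subgroup_motive_def)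

end

text \<open>The torus has finitely many points over a finite field, so \<open>W\<close> is finite
  and is an extension of the lattice of rank zero.\<close>

lemma torsion_of_subgroup:
  assumes q: "prime q" and W: "subgroup W (Gm2 (F_p q))"
  shows "split_torsion_1_motive (F_p q) (subgroup_motive (F_p q) W :: (int, 'r, int \<times> int) toric_motive)"
proof -
  have "Units (F_p q) \<subseteq> {0..int q - 1}"
    by (auto simp: F_p_def residue_ring_def Units_def)
  then have "finite (carrier (Gm2 (F_p q)))"
    using finite_subset by auto
  then have "finite W" using subgroup.subset[OF W] finite_subset by blast
  moreover have "comm_group ((Gm2 (F_p q))\<lparr>carrier := W\<rparr>)"
    using Gm2_comm_group[OF F_p_cring[OF q]] W by (rule subgroup_comm_group)
  ultimately have "lattice_by_finite ((Gm2 (F_p q))\<lparr>carrier := W\<rparr>)"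
    by (intro finite_lattice_by_finite) simp_all
  then show ?thesis
    using subgroup_motive_diagram[OF F_p_cring[OF q] W]
    unfolding split_torsion_1_motive_def by (auto simp: subgroup_motive_def)
qed

theorem theorem3p8:
  fixes t :: nat
    and p :: "nat \<Rightarrow> nat \<Rightarrow> nat"
    and n N N' :: "nat \<Rightarrow> nat"
    and T1 T2 :: "nat set"
  assumes t: "t \<ge> 1"
    and primes: "\<And>i j. j \<in> {1..t} \<Longrightarrow> i \<in> {1..n j} \<Longrightarrow> prime (p i j)"
    and card_S: "\<And>j. j \<in> {1..t} \<Longrightarrow> card (S_set p n j) = n j"
    and n_gt: "\<And>j. j \<in> {1..t} \<Longrightarrow> n j > 2"
    and disj: "\<And>j k. j \<in> {1..t} \<Longrightarrow> k \<in> {1..t} \<Longrightarrow> j \<noteq> k \<Longrightarrow> S_set p n j \<inter> S_set p n k = {}"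
    and N_pos: "\<And>j. j \<in> {1..t} \<Longrightarrow> N j > 0"
    and N'_pos: "\<And>j. j \<in> {1..t} \<Longrightarrow> N' j > 0"
    and T_sub: "T1 \<subseteq> {1..t}" "T2 \<subseteq> {1..t}"
    and T_disj: "T1 \<inter> T2 = {}"
  defines "\<Sigma> \<equiv> Sigma_set p n t"
    and "\<Gamma> \<equiv> Gam p n N T2 t"
    and "\<Gamma>' \<equiv> Gam' p n N' T1 t"
    and "\<Gamma>\<Gamma>' \<equiv> Gam p n N T2 t <#>\<^bsub>ambient p n t\<^esub> Gam' p n N' T1 t"
  shows "(\<forall>\<Gamma>\<^sub>0 \<in> {\<Gamma>, \<Gamma>', \<Gamma> \<inter> \<Gamma>', \<Gamma>\<Gamma>'}.
            subgroup \<Gamma>\<^sub>0 (Gm2 (Z_inv \<Sigma>)) \<and>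
            split_deligne_1_motive (Z_inv \<Sigma>)
              (subgroup_motive (Z_inv \<Sigma>) \<Gamma>\<^sub>0 :: (rat, 'r, rat \<times> rat) toric_motive)) \<and>
         (\<forall>q. prime q \<and> q \<notin> \<Sigma> \<longrightarrow>
            (\<forall>\<Gamma>\<^sub>0 \<in> {\<Gamma>, \<Gamma>', \<Gamma> \<inter> \<Gamma>', \<Gamma>\<Gamma>'}.
               split_torsion_1_motive (F_p q)
                 (subgroup_motive (F_p q) (r_p q ` \<Gamma>\<^sub>0) :: (int, 'r, int \<times> int) toric_motive)) \<and>
            (subgroup_motive (F_p q) (r_p q ` \<Gamma>) :: (int, 'r, int \<times> int) toric_motive)
              = subgroup_motive (F_p q) (r_p q ` \<Gamma>') \<and>
            (subgroup_motive (F_p q) (r_p q ` \<Gamma>') :: (int, 'r, int \<times> int) toric_motive)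
              = subgroup_motive (F_p q) (r_p q ` (\<Gamma> \<inter> \<Gamma>')) \<and>
            (subgroup_motive (F_p q) (r_p q ` (\<Gamma> \<inter> \<Gamma>')) :: (int, 'r, int \<times> int) toric_motive)
              = subgroup_motive (F_p q) (r_p q ` \<Gamma>\<Gamma>'))"
proof -
  interpret prime_families t p n
  proof
    show "n j > 0" if "j \<in> {1..t}" for j using n_gt[OF that] by simp
  qed (rule primes)
  have sub: "subgroup \<Gamma> A" "subgroup \<Gamma>' A"
    unfolding \<Gamma>_def \<Gamma>'_def by (rule Gam_subgroup)+
  have pos: "\<Gamma> \<subseteq> Pos" "\<Gamma>' \<subseteq> Pos"
    unfolding \<Gamma>_def \<Gamma>'_def using M_grp_Pos lam_Pos by (intro Gam_subset Pos_subgroup; blast)+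
  have \<Gamma>\<Gamma>': "\<Gamma>\<Gamma>' = \<Gamma> <#>\<^bsub>A\<^esub> \<Gamma>'" by (simp add: \<Gamma>\<Gamma>'_def \<Gamma>_def \<Gamma>'_def)
  have all: "subgroup \<Gamma>\<^sub>0 A \<and> \<Gamma>\<^sub>0 \<subseteq> Pos" if "\<Gamma>\<^sub>0 \<in> {\<Gamma>, \<Gamma>', \<Gamma> \<inter> \<Gamma>', \<Gamma>\<Gamma>'}" for \<Gamma>\<^sub>0
    using that sub pos A.mult_subgroups[OF sub] A.subgroups_Inter_pair[OF sub]
      set_mult_subset_subgroup[OF Pos_subgroup pos] unfolding \<Gamma>\<Gamma>' by blast
  have "M_all \<subseteq> \<Gamma>" "M_all \<subseteq> \<Gamma>'"
    unfolding \<Gamma>_def \<Gamma>'_def by (rule M_all_subset_Gam)+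
  \<comment> \<open>This sandwich lets one lower and one upper bound serve all four groups.\<close>
  then have between: "M_all \<subseteq> \<Gamma>\<^sub>0 \<and> \<Gamma>\<^sub>0 \<subseteq> \<Gamma>\<Gamma>'" if "\<Gamma>\<^sub>0 \<in> {\<Gamma>, \<Gamma>', \<Gamma> \<inter> \<Gamma>', \<Gamma>\<Gamma>'}" for \<Gamma>\<^sub>0
    using that subset_set_mult[OF A.is_group sub] unfolding \<Gamma>\<Gamma>' by blast
  \<comment> \<open>\<open>subgroup_motive\<close> depends only on the set of points it is given, so
    equality of these images yields equality of the motives.\<close>
  have img: "r_p q ` \<Gamma>\<^sub>0 = r_p q ` M_all"
    if "prime q" "q \<notin> \<Sigma>" "\<Gamma>\<^sub>0 \<in> {\<Gamma>, \<Gamma>', \<Gamma> \<inter> \<Gamma>', \<Gamma>\<Gamma>'}" for q \<Gamma>\<^sub>0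
  proof (rule equalityI)
    show "r_p q ` M_all \<subseteq> r_p q ` \<Gamma>\<^sub>0" using between[OF that(3)] by blast
    have "r_p q ` \<Gamma>\<^sub>0 \<subseteq> r_p q ` \<Gamma>\<Gamma>'" using between[OF that(3)] by blast
    also have "\<dots> \<subseteq> r_p q ` M_all"
      unfolding \<Gamma>\<Gamma>'_def using that(1,2)[unfolded \<Sigma>_def] by (rule Gam_reduction(2))
    finally show "r_p q ` \<Gamma>\<^sub>0 \<subseteq> r_p q ` M_all" .
  qed
  show ?thesis
  proof (intro conjI ballI allI impI)
    fix \<Gamma>\<^sub>0 assume "\<Gamma>\<^sub>0 \<in> {\<Gamma>, \<Gamma>', \<Gamma> \<inter> \<Gamma>', \<Gamma>\<Gamma>'}"
    from all[OF this]
    show "subgroup \<Gamma>\<^sub>0 (Gm2 (Z_inv \<Sigma>))"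
      "split_deligne_1_motive (Z_inv \<Sigma>)
        (subgroup_motive (Z_inv \<Sigma>) \<Gamma>\<^sub>0 :: (rat, 'r, rat \<times> rat) toric_motive)"
      unfolding \<Sigma>_def using deligne_of_Pos by blast+
  next
    fix q \<Gamma>\<^sub>0 assume q: "prime q \<and> q \<notin> \<Sigma>" and \<Gamma>\<^sub>0: "\<Gamma>\<^sub>0 \<in> {\<Gamma>, \<Gamma>', \<Gamma> \<inter> \<Gamma>', \<Gamma>\<Gamma>'}"
    show "split_torsion_1_motive (F_p q)
        (subgroup_motive (F_p q) (r_p q ` \<Gamma>\<^sub>0) :: (int, 'r, int \<times> int) toric_motive)"
      using q \<Gamma>\<^sub>0 Gam_reduction(1)[of q] unfolding img[OF conjunct1[OF q] conjunct2[OF q] \<Gamma>\<^sub>0] \<Sigma>_def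
      by (blast intro: torsion_of_subgroup)
  qed (simp_all add: img)
qed

end
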